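(* Let $\varnothing\ne\Omega\subset\mathcal{D}_n$, let $E\subset\mathbb{H}_n(\mathbb{F}_q)$, and let $1\le\lambda\le q$ be an integer. Suppose that for every $\vartheta\in\Omega$ there exists a horizontal line $L_\vartheta$ satisfying $\mathrm{Dir}(L_\vartheta)=\vartheta$ and $|E\cap L_\vartheta|\ge\lambda$. Then $$|E|\gtrsim_n\frac{\lambda^r|\Omega|}{q^{r-1}},$$ i.e. there is a constant $c=c(n)>0$, independent of $q,\Omega,E,\lambda$, with $|E|\ge c\,\lambda^r|\Omega|q^{-(r-1)}$.
   Context: $n\ge 2$ is a fixed integer, $r:=2n$, $q$ is an odd prime power, and $V:=\mathbb{F}_q^n\times\mathbb{F}_q^n=\mathbb{F}_q^r$ carries the alternating form $\sigma((x,y),(x',y'))=x\cdot y'-y\cdot x'$. The finite Heisenberg group is $\mathbb{H}_n(\mathbb{F}_q)=V\times\mathbb{F}_q$ with $(z,t)\cdot(z',t')=(z+z',t+t'+\sigma(z,z'))$. For $p=(z_0,t_0)\in\mathbb{H}_n(\mathbb{F}_q)$ and $w\in V\setminus\{0\}$, the horizontal line through $p$ with spatial direction $[w]$ is $L_{p,w}=\{(z_0+sw,\,t_0+s\sigma(z_0,w)):s\in\mathbb{F}_q\}$; its refined direction is the projective point $\mathrm{Dir}(L_{p,w})=[w:\sigma(z_0,w)]\in\mathbb{P}^r(\mathbb{F}_q)$ (independent of the choices of base point and representative). The set of refined directions is $\mathcal{D}_n=\{[w:c]\in\mathbb{P}^r(\mathbb{F}_q):w\in V\setminus\{0\},\,c\in\mathbb{F}_q\}$.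 *)

theory Defs
  imports "HOL-Algebra.Algebra"
begin

text \<open>
  The field \<open>\<F>\<^sub>q\<close> is a ring record \<open>R\<close> rather than a type of sort \<open>{field, finite}\<close>, because the
  constant in the theorem must be chosen before \<open>q\<close>. The carrier lives in an arbitrary type
  \<open>'a\<close>; since every finite field is isomorphic to one carried by a subset of \<open>nat\<close>, already the
  instance \<open>'a = nat\<close> gives one constant for all finite fields. Vectors in \<open>\<F>\<^sub>q\<^sup>n\<close> are the functions in
  \<open>{..<n} \<rightarrow>\<^sub>E carrier R\<close>, that is, they take the value \<open>undefined\<close> from index \<open>n\<close> on.
\<close>

type_synonym 'a vec2 = "(nat \<Rightarrow> 'a) \<times> (nat \<Rightarrow> 'a)"

definition V_space :: "('a, 'm) ring_scheme \<Rightarrow> nat \<Rightarrow> 'a vec2 set" where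
  "V_space R n = ({..<n} \<rightarrow>\<^sub>E carrier R) \<times> ({..<n} \<rightarrow>\<^sub>E carrier R)"

definition V_zero :: "('a, 'm) ring_scheme \<Rightarrow> nat \<Rightarrow> 'a vec2" where
  "V_zero R n = ((\<lambda>i\<in>{..<n}. \<zero>\<^bsub>R\<^esub>), (\<lambda>i\<in>{..<n}. \<zero>\<^bsub>R\<^esub>))"

definition V_add :: "('a, 'm) ring_scheme \<Rightarrow> nat \<Rightarrow> 'a vec2 \<Rightarrow> 'a vec2 \<Rightarrow> 'a vec2" where
  "V_add R n z z' =
     ((\<lambda>i\<in>{..<n}. fst z i \<oplus>\<^bsub>R\<^esub> fst z' i), (\<lambda>i\<in>{..<n}. snd z i \<oplus>\<^bsub>R\<^esub> snd z' i))"

definition V_smult :: "('a, 'm) ring_scheme \<Rightarrow> nat \<Rightarrow> 'a \<Rightarrow> 'a vec2 \<Rightarrow> 'a vec2" where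
  "V_smult R n s z =
     ((\<lambda>i\<in>{..<n}. s \<otimes>\<^bsub>R\<^esub> fst z i), (\<lambda>i\<in>{..<n}. s \<otimes>\<^bsub>R\<^esub> snd z i))"

definition dot :: "('a, 'm) ring_scheme \<Rightarrow> nat \<Rightarrow> (nat \<Rightarrow> 'a) \<Rightarrow> (nat \<Rightarrow> 'a) \<Rightarrow> 'a" where
  "dot R n x y = (\<Oplus>\<^bsub>R\<^esub>i\<in>{..<n}. x i \<otimes>\<^bsub>R\<^esub> y i)"

definition sigma :: "('a, 'm) ring_scheme \<Rightarrow> nat \<Rightarrow> 'a vec2 \<Rightarrow> 'a vec2 \<Rightarrow> 'a" where
  "sigma R n z z' = dot R n (fst z) (snd z') \<ominus>\<^bsub>R\<^esub> dot R n (snd z) (fst z')"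

definition heisenberg :: "('a, 'm) ring_scheme \<Rightarrow> nat \<Rightarrow> ('a vec2 \<times> 'a) monoid" where
  "heisenberg R n =
     \<lparr>carrier = V_space R n \<times> carrier R,
      monoid.mult = (\<lambda>(z, t) (z', t'). (V_add R n z z', t \<oplus>\<^bsub>R\<^esub> t' \<oplus>\<^bsub>R\<^esub> sigma R n z z')),
      monoid.one = (V_zero R n, \<zero>\<^bsub>R\<^esub>)\<rparr>"

text \<open>
  Projective \<open>2n\<close>-space is the quotient of the nonzero vectors of \<open>V \<times> \<F>\<^sub>q = \<F>\<^sub>q\<^bsup>2n+1\<^esup>\<close> by
  multiplication by nonzero scalars.
\<close>

definition proj_rel :: "('a, 'm) ring_scheme \<Rightarrow> nat \<Rightarrow> (('a vec2 \<times> 'a) \<times> ('a vec2 \<times> 'a)) set" where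
  "proj_rel R n =
     {((w, c), (w', c')).
        (w, c) \<in> V_space R n \<times> carrier R - {(V_zero R n, \<zero>\<^bsub>R\<^esub>)} \<and>
        (w', c') \<in> V_space R n \<times> carrier R - {(V_zero R n, \<zero>\<^bsub>R\<^esub>)} \<and>
        (\<exists>a\<in>carrier R - {\<zero>\<^bsub>R\<^esub>}. w' = V_smult R n a w \<and> c' = a \<otimes>\<^bsub>R\<^esub> c)}"

definition proj_space :: "('a, 'm) ring_scheme \<Rightarrow> nat \<Rightarrow> ('a vec2 \<times> 'a) set set" where
  "proj_space R n = (V_space R n \<times> carrier R - {(V_zero R n, \<zero>\<^bsub>R\<^esub>)}) // proj_rel R n"

definition proj_point :: "('a, 'm) ring_scheme \<Rightarrow> nat \<Rightarrow> 'a vec2 \<Rightarrow> 'a \<Rightarrow> ('a vec2 \<times> 'a) set" where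
  "proj_point R n w c = proj_rel R n `` {(w, c)}"

definition refined_directions :: "('a, 'm) ring_scheme \<Rightarrow> nat \<Rightarrow> ('a vec2 \<times> 'a) set set" where
  "refined_directions R n =
     {proj_point R n w c | w c. w \<in> V_space R n - {V_zero R n} \<and> c \<in> carrier R}"

definition hline ::
  "('a, 'm) ring_scheme \<Rightarrow> nat \<Rightarrow> 'a vec2 \<times> 'a \<Rightarrow> 'a vec2 \<Rightarrow> ('a vec2 \<times> 'a) set" where
  "hline R n p w =
     {(V_add R n (fst p) (V_smult R n s w), snd p \<oplus>\<^bsub>R\<^esub> s \<otimes>\<^bsub>R\<^esub> sigma R n (fst p) w) | s.
        s \<in> carrier R}"

definition horizontal_lines :: "('a, 'm) ring_scheme \<Rightarrow> nat \<Rightarrow> ('a vec2 \<times> 'a) set set" where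
  "horizontal_lines R n =
     {hline R n p w | p w. p \<in> carrier (heisenberg R n) \<and> w \<in> V_space R n - {V_zero R n}}"

text \<open>
  The description below has a unique solution on horizontal lines over a field; see
  \<open>Dir_hline\<close> at the end of this theory.
\<close>

definition Dir ::
  "('a, 'm) ring_scheme \<Rightarrow> nat \<Rightarrow> ('a vec2 \<times> 'a) set \<Rightarrow> ('a vec2 \<times> 'a) set" where
  "Dir R n L =
     (THE \<theta>. \<exists>p w. p \<in> carrier (heisenberg R n) \<and> w \<in> V_space R n - {V_zero R n} \<and>
        L = hline R n p w \<and> \<theta> = proj_point R n w (sigma R n (fst p) w))"

context field
begin

lemma dot_closed:
  assumes "x \<in> {..<n} \<rightarrow>\<^sub>E carrier R" "y \<in> {..<n} \<rightarrow>\<^sub>E carrier R"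
  shows "dot R n x y \<in> carrier R"
  unfolding dot_def using assms by (intro finsum_closed) (auto simp: PiE_iff)

lemma sigma_closed:
  assumes "z \<in> V_space R n" "z' \<in> V_space R n"
  shows "sigma R n z z' \<in> carrier R"
  using assms unfolding sigma_def V_space_def mem_Times_iff
  by (intro minus_closed dot_closed) simp_all

lemma V_eqI:
  assumes "z \<in> V_space R n" "z' \<in> V_space R n"
    and "\<And>i. i < n \<Longrightarrow> fst z i = fst z' i" "\<And>i. i < n \<Longrightarrow> snd z i = snd z' i"
  shows "z = z'"
proof (rule prod_eqI)
  have 1: "fst z \<in> {..<n} \<rightarrow>\<^sub>E carrier R" "fst z' \<in> {..<n} \<rightarrow>\<^sub>E carrier R"
    and 2: "snd z \<in> {..<n} \<rightarrow>\<^sub>E carrier R" "snd z' \<in> {..<n} \<rightarrow>\<^sub>E carrier R"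
    using assms(1,2) by (simp_all add: V_space_def mem_Times_iff)
  show "fst z = fst z'"
    by (rule PiE_ext[OF 1]) (simp add: assms(3))
  show "snd z = snd z'"
    by (rule PiE_ext[OF 2]) (simp add: assms(4))
qed

lemma V_coord:
  assumes "z \<in> V_space R n" "i < n"
  shows "fst z i \<in> carrier R" "snd z i \<in> carrier R"
  using assms by (simp_all add: V_space_def mem_Times_iff PiE_iff)

lemma V_zero_closed: "V_zero R n \<in> V_space R n"
  by (simp add: V_zero_def V_space_def restrict_PiE_iff)

lemma V_add_closed: "z \<in> V_space R n \<Longrightarrow> z' \<in> V_space R n \<Longrightarrow> V_add R n z z' \<in> V_space R n"
  by (simp add: V_add_def V_space_def restrict_PiE_iff PiE_iff mem_Times_iff)

lemma V_smult_closed: "a \<in> carrier R \<Longrightarrow> z \<in> V_space R n \<Longrightarrow> V_smult R n a z \<in> V_space R n"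
  by (simp add: V_smult_def V_space_def restrict_PiE_iff PiE_iff mem_Times_iff)

lemma V_smult_smult:
  assumes "w \<in> V_space R n" "a \<in> carrier R" "b \<in> carrier R"
  shows "V_smult R n a (V_smult R n b w) = V_smult R n (a \<otimes> b) w"
  by (rule V_eqI[of _ n]) (use assms in \<open>simp_all add: V_smult_closed\<close>,
      simp_all add: V_smult_def V_coord m_assoc)

lemma V_smult_one:
  assumes "w \<in> V_space R n"
  shows "V_smult R n \<one> w = w"
  by (rule V_eqI[of _ n]) (use assms in \<open>simp_all add: V_smult_closed\<close>,
      simp_all add: V_smult_def V_coord)

lemma V_smult_zero:
  assumes "w \<in> V_space R n"
  shows "V_smult R n \<zero> w = V_zero R n"
  by (rule V_eqI[of _ n]) (use assms in \<open>simp_all add: V_smult_closed V_zero_closed\<close>,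
      simp_all add: V_smult_def V_zero_def V_coord)

lemma V_add_zero:
  assumes "z \<in> V_space R n"
  shows "V_add R n z (V_zero R n) = z"
  by (rule V_eqI[of _ n]) (use assms in \<open>simp_all add: V_add_closed V_zero_closed\<close>,
      simp_all add: V_add_def V_zero_def V_coord)

lemma equiv_proj_rel:
  "equiv (V_space R n \<times> carrier R - {(V_zero R n, \<zero>)}) (proj_rel R n)"
proof (rule equivI)
  show "proj_rel R n \<subseteq> (V_space R n \<times> carrier R - {(V_zero R n, \<zero>)}) \<times>
      (V_space R n \<times> carrier R - {(V_zero R n, \<zero>)})"
    by (auto simp: proj_rel_def)
  show "refl_on (V_space R n \<times> carrier R - {(V_zero R n, \<zero>)}) (proj_rel R n)"
    by (rule refl_onI)
      (auto simp: proj_rel_def V_smult_one intro!: bexI[of _ \<one>])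
  show "sym (proj_rel R n)"
  proof (rule symI, clarify)
    fix w c w' c' assume *: "((w, c), (w', c')) \<in> proj_rel R n"
    then obtain a where a: "a \<in> carrier R" "a \<noteq> \<zero>" "w' = V_smult R n a w" "c' = a \<otimes> c"
      by (auto simp: proj_rel_def)
    have "a \<in> Units R" using a field_Units by simp
    then have U: "inv a \<in> carrier R" "inv a \<otimes> a = \<one>" by simp_all
    have U0: "inv a \<noteq> \<zero>"
    proof
      assume "inv a = \<zero>"
      with U a show False by simp
    qed
    have w: "w \<in> V_space R n" "c \<in> carrier R" using * by (auto simp: proj_rel_def)
    have "w = V_smult R n (inv a) w'" "c = inv a \<otimes> c'"
      using a U w by (simp_all add: V_smult_smult V_smult_one m_assoc[symmetric])
    then show "((w', c'), (w, c)) \<in> proj_rel R n"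
      using * U(1) U0 by (auto simp: proj_rel_def)
  qed
  show "trans (proj_rel R n)"
  proof (rule transI, clarify)
    fix w c w' c' w'' c''
    assume *: "((w, c), (w', c')) \<in> proj_rel R n" "((w', c'), (w'', c'')) \<in> proj_rel R n"
    obtain a where a: "a \<in> carrier R" "a \<noteq> \<zero>" "w' = V_smult R n a w" "c' = a \<otimes> c"
      using *(1) by (auto simp: proj_rel_def)
    obtain b where b: "b \<in> carrier R" "b \<noteq> \<zero>" "w'' = V_smult R n b w'" "c'' = b \<otimes> c'"
      using *(2) by (auto simp: proj_rel_def)
    have w: "w \<in> V_space R n" "c \<in> carrier R" using * by (auto simp: proj_rel_def)
    have "b \<otimes> a \<in> carrier R - {\<zero>}" using a b integral by auto
    moreover have "w'' = V_smult R n (b \<otimes> a) w" "c'' = (b \<otimes> a) \<otimes> c"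
      using a b w by (simp_all add: V_smult_smult m_assoc)
    ultimately have "\<exists>a\<in>carrier R - {\<zero>}. w'' = V_smult R n a w \<and> c'' = a \<otimes> c"
      by blast
    then show "((w, c), (w'', c'')) \<in> proj_rel R n"
      using * unfolding proj_rel_def by simp
  qed
qed

lemma cancel_step:
  assumes "x \<in> carrier R" "y \<in> carrier R" "u \<in> carrier R" "v \<in> carrier R"
    and "s0 \<in> carrier R" "s1 \<in> carrier R"
    and "u = x \<oplus> s0 \<otimes> y" "u \<oplus> v = x \<oplus> s1 \<otimes> y"
  shows "v = (s1 \<ominus> s0) \<otimes> y"
proof -
  have "v = (u \<oplus> v) \<ominus> u" using assms(3,4) by algebra
  also have "\<dots> = (x \<oplus> s1 \<otimes> y) \<ominus> (x \<oplus> s0 \<otimes> y)"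
    by (subst assms(8)) (simp only: assms(7))
  also have "\<dots> = (s1 \<ominus> s0) \<otimes> y" using assms(1,2,5,6) by algebra
  finally show ?thesis .
qed

lemma hline_eq_imp:
  assumes p: "p \<in> carrier (heisenberg R n)" and w: "w \<in> V_space R n - {V_zero R n}"
    and p': "p' \<in> carrier (heisenberg R n)" and w': "w' \<in> V_space R n - {V_zero R n}"
    and eq: "hline R n p w = hline R n p' w'"
  shows "proj_point R n w (sigma R n (fst p) w) = proj_point R n w' (sigma R n (fst p') w')"
proof -
  obtain z t where [simp]: "p = (z, t)" by (cases p)
  obtain z' t' where [simp]: "p' = (z', t')" by (cases p')
  have zt: "z \<in> V_space R n" "t \<in> carrier R" "z' \<in> V_space R n" "t' \<in> carrier R"
    using p p' by (auto simp: heisenberg_def)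
  have wV: "w \<in> V_space R n" "w' \<in> V_space R n" using w w' by auto
  let ?c = "sigma R n z w" and ?c' = "sigma R n z' w'"
  have c: "?c \<in> carrier R" "?c' \<in> carrier R" using zt wV by (auto intro: sigma_closed)
  have mem: "(V_add R n z' (V_smult R n s w'), t' \<oplus> s \<otimes> ?c') \<in> hline R n p w"
    if "s \<in> carrier R" for s
    using that by (subst eq) (auto simp: hline_def)
  have "V_add R n z' (V_smult R n \<zero> w') = z'"
    using zt wV by (simp add: V_smult_zero V_add_zero)
  moreover have "t' \<oplus> \<zero> \<otimes> ?c' = t'"
    using zt(4) c(2) by simp
  ultimately have "(z', t') \<in> hline R n p w"
    using mem[OF zero_closed] by simp
  then obtain s0 where s0: "s0 \<in> carrier R" "z' = V_add R n z (V_smult R n s0 w)"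
      "t' = t \<oplus> s0 \<otimes> ?c"
    unfolding hline_def by auto
  have "(V_add R n z' w', t' \<oplus> ?c') \<in> hline R n p w"
    using mem[OF one_closed] V_smult_one[OF wV(2)] l_one[OF c(2)] by simp
  then obtain s1 where s1: "s1 \<in> carrier R" "V_add R n z' w' = V_add R n z (V_smult R n s1 w)"
      "t' \<oplus> ?c' = t \<oplus> s1 \<otimes> ?c"
    unfolding hline_def by auto
  let ?a = "s1 \<ominus> s0"
  have a: "?a \<in> carrier R" using s0 s1 by simp
  have c': "?c' = ?a \<otimes> ?c"
    by (rule cancel_step[OF zt(2) c(1) zt(4) c(2) s0(1) s1(1) s0(3) s1(3)])
  have crd: "fst w' i = ?a \<otimes> fst w i" "snd w' i = ?a \<otimes> snd w i" if "i < n" for i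
  proof -
    have cl: "fst z i \<in> carrier R" "fst z' i \<in> carrier R" "fst w i \<in> carrier R"
        "fst w' i \<in> carrier R" "snd z i \<in> carrier R" "snd z' i \<in> carrier R"
        "snd w i \<in> carrier R" "snd w' i \<in> carrier R"
      using zt(1,3) wV that by (simp_all only: V_coord)
    have 0: "fst z' i = fst z i \<oplus> s0 \<otimes> fst w i" "snd z' i = snd z i \<oplus> s0 \<otimes> snd w i"
      using that by (subst s0(2), simp add: V_add_def V_smult_def)+
    have 1: "fst z' i \<oplus> fst w' i = fst z i \<oplus> s1 \<otimes> fst w i"
        "snd z' i \<oplus> snd w' i = snd z i \<oplus> s1 \<otimes> snd w i"
      using arg_cong[OF s1(2), of "\<lambda>v. fst v i"] arg_cong[OF s1(2), of "\<lambda>v. snd v i"] that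
      by (simp_all add: V_add_def V_smult_def)
    show "fst w' i = ?a \<otimes> fst w i"
      by (rule cancel_step[OF cl(1,3,2,4) s0(1) s1(1) 0(1) 1(1)])
    show "snd w' i = ?a \<otimes> snd w i"
      by (rule cancel_step[OF cl(5,7,6,8) s0(1) s1(1) 0(2) 1(2)])
  qed
  have ww: "w' = V_smult R n ?a w"
  proof (rule V_eqI[OF wV(2) V_smult_closed[OF a wV(1)]])
    fix i assume i: "i < n"
    show "fst w' i = fst (V_smult R n ?a w) i" "snd w' i = snd (V_smult R n ?a w) i"
      using i crd[OF i] by (simp_all add: V_smult_def)
  qed
  have "?a \<noteq> \<zero>"
  proof
    assume "?a = \<zero>"
    then have "w' = V_zero R n" using ww V_smult_zero[OF wV(1)] by simp
    with w' show False by simp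
  qed
  then have "\<exists>a\<in>carrier R - {\<zero>}. w' = V_smult R n a w \<and> ?c' = a \<otimes> ?c"
    using ww c' a by blast
  then have "((w, ?c), (w', ?c')) \<in> proj_rel R n"
    unfolding proj_rel_def using w w' c by simp
  then show ?thesis
    unfolding proj_point_def fst_conv \<open>p = (z, t)\<close> \<open>p' = (z', t')\<close>
    by (rule equiv_class_eq[OF equiv_proj_rel])
qed

lemma Dir_hline:
  assumes "p \<in> carrier (heisenberg R n)" "w \<in> V_space R n - {V_zero R n}"
  shows "Dir R n (hline R n p w) = proj_point R n w (sigma R n (fst p) w)"
  unfolding Dir_def
proof (rule the_equality)
  fix \<theta>
  assume "\<exists>p' w'. p' \<in> carrier (heisenberg R n) \<and> w' \<in> V_space R n - {V_zero R n} \<and>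
    hline R n p w = hline R n p' w' \<and> \<theta> = proj_point R n w' (sigma R n (fst p') w')"
  then show "\<theta> = proj_point R n w (sigma R n (fst p) w)"
    using hline_eq_imp[OF assms] by metis
qed (use assms in blast)

lemma refined_directions_subset: "refined_directions R n \<subseteq> proj_space R n"
  by (auto simp: refined_directions_def proj_space_def proj_point_def intro!: quotientI)

end

end

theory Submission
  imports Defs
begin

text \<open>
  The proof is the polynomial method with multiplicities, where the multiplicity is imposed only
  along the contact hyperplanes. Let \<open>r = 2 n\<close> and \<open>m \<approx> (r + 2) q / \<lambda>\<close>. Look for a polynomial \<open>P\<close> of degree
  less than \<open>\<lambda> m\<close> on \<open>V \<times> \<F>\<^sub>q\<close> such that for every \<open>(z, t) \<in> E\<close> the function
  \<open>w \<mapsto> P (z + w, t + \<sigma>(z, w))\<close> has no monomial with all exponents below \<open>m\<close>; these are only \<open>m\<^sup>r\<close>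
  linear conditions per point, because the contact hyperplane has dimension \<open>r\<close> rather than \<open>r + 1\<close>.
  A horizontal line lies in the contact hyperplane of each of its points, so \<open>P\<close> restricted to
  \<open>L\<^sub>\<theta>\<close> vanishes to order \<open>m\<close> at \<open>\<lambda>\<close> points, hence identically, and the top-degree part
  of \<open>P\<close> vanishes at \<open>\<theta>\<close>. In each of \<open>q\<close> consecutive degrees from \<open>(r + 1) (q - 1)\<close> on there are
  forms separating the points of \<open>\<Omega>\<close>, so taking \<open>P\<close> in their span shows that
  \<open>q |\<Omega>| \<le> |E| m\<^sup>r\<close>, which is the claim.
\<close>

section \<open>Univariate polynomials with prescribed zeros\<close>

text \<open>Modulo \<open>z\<close> the element \<open>y\<close> equals the unit
  \<open>y \<ominus> z\<close>, so \<open>y\<close> and \<open>z\<close> are coprime in a strong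
  sense: every factor \<open>z\<close> of \<open>y \<otimes> x\<close> passes to \<open>x\<close>.
  The induction transfers one factor at a time.\<close>

lemma (in domain) pow_divides_cancel:
  assumes yzx: "y \<in> carrier R" "z \<in> carrier R" "x \<in> carrier R"
    and "z \<noteq> \<zero>" "y \<ominus> z \<in> Units R"
    and "z [^] (a::nat) divides y \<otimes> x"
  shows "z [^] a divides x"
  using assms(6)
proof (induction a)
  case 0
  then show ?case using yzx by (auto simp: factor_def)
next
  case (Suc a)
  obtain u where u: "u \<in> carrier R" "y \<otimes> x = z [^] Suc a \<otimes> u"
    using Suc.prems by (auto simp: factor_def)
  have "y \<otimes> x = z [^] a \<otimes> (z \<otimes> u)" using u yzx by (simp add: m_ac)
  then have "z [^] a divides y \<otimes> x" using u yzx by (auto simp: factor_def)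
  then obtain v where v: "v \<in> carrier R" "x = z [^] a \<otimes> v"
    using Suc.IH by (auto simp: factor_def)
  have "z [^] a \<otimes> (y \<otimes> v) = z [^] a \<otimes> (z \<otimes> u)"
    using u(1) v(1) yzx u(2) unfolding v(2) by (simp add: m_ac)
  moreover have "z [^] a \<noteq> \<zero>" using yzx(2) assms(4) by (induction a) (auto simp: integral_iff)
  ultimately have yv: "y \<otimes> v = z \<otimes> u"
    using yzx u v by (subst (asm) m_lcancel) auto
  define d where "d = y \<ominus> z"
  have d: "d \<in> Units R" "d \<in> carrier R" using assms(5) by (auto simp: d_def)
  \<comment> \<open>The unit \<open>d\<close> times \<open>v\<close> is a multiple of
    \<open>z\<close>, so \<open>v\<close> itself supplies the missing factor
    \<open>z\<close>.\<close>
  have "d \<otimes> v = y \<otimes> v \<ominus> z \<otimes> v" unfolding d_def using yzx v by algebra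
  also have "\<dots> = z \<otimes> (u \<ominus> v)" unfolding yv using yzx u v by algebra
  finally have dv: "d \<otimes> v = z \<otimes> (u \<ominus> v)" .
  have "v = inv d \<otimes> (d \<otimes> v)" using d v by (simp add: m_assoc[symmetric])
  also have "\<dots> = z \<otimes> (inv d \<otimes> (u \<ominus> v))" using dv d yzx u v by (simp add: m_ac)
  finally have "x = z [^] Suc a \<otimes> (inv d \<otimes> (u \<ominus> v))"
    using v d yzx u by (metis Units_inv_closed m_assoc m_closed minus_closed nat_pow_Suc nat_pow_closed)
  then show ?case using d u v by (auto simp: factor_def)
qed

lemma (in domain) pow_divides_cancel_pow:
  assumes "y \<in> carrier R" "z \<in> carrier R" "x \<in> carrier R"
    and "z \<noteq> \<zero>" "y \<ominus> z \<in> Units R"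
    and "z [^] (a::nat) divides y [^] (b::nat) \<otimes> x"
  shows "z [^] a divides x"
  using assms(6)
proof (induction b)
  case 0
  then show ?case using assms(3) by simp
next
  case (Suc b)
  have "z [^] a divides y \<otimes> (y [^] b \<otimes> x)"
    using Suc.prems assms(1,3) by (simp add: m_ac)
  then have "z [^] a divides y [^] b \<otimes> x"
    using pow_divides_cancel[OF assms(1,2) _ assms(4,5)] assms(1,3) by simp
  then show ?case by (rule Suc.IH)
qed

context UP_domain
begin

section \<open>Powers of distinct linear factors\<close>

abbreviation mon :: "'a \<Rightarrow> nat \<Rightarrow> nat \<Rightarrow> 'a" where "mon \<equiv> up_ring.monom P"
abbreviation cf :: "(nat \<Rightarrow> 'a) \<Rightarrow> nat \<Rightarrow> 'a" where "cf \<equiv> up_ring.coeff P"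

abbreviation X_minus :: "'a \<Rightarrow> nat \<Rightarrow> 'a" where
  "X_minus s \<equiv> mon \<one> 1 \<ominus>\<^bsub>P\<^esub> mon s 0"

lemma X_minus_closed: "s \<in> carrier R \<Longrightarrow> X_minus s \<in> carrier P"
  by (intro P.minus_closed monom_closed) auto

lemma deg_X_minus: "s \<in> carrier R \<Longrightarrow> deg R (X_minus s) = 1"
  using deg_minus_monom[of s] R.one_not_zero by blast

lemma X_minus_nonzero: "s \<in> carrier R \<Longrightarrow> X_minus s \<noteq> \<zero>\<^bsub>P\<^esub>"
  by (rule deg_nzero_nzero) (subst deg_X_minus, simp_all)

text \<open>The difference is the constant \<open>t \<ominus> s\<close>. Linear factors at points
  that differ by a unit thus satisfy the unit condition of
  \<open>pow_divides_cancel_pow\<close>.\<close>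

lemma X_minus_diff_unit:
  assumes "s \<in> carrier R" "t \<in> carrier R" "t \<ominus> s \<in> Units R"
  shows "X_minus s \<ominus>\<^bsub>P\<^esub> X_minus t \<in> Units P"
proof -
  define d where "d = t \<ominus> s"
  have d: "d \<in> carrier R" and U: "d \<in> Units R" using assms by (auto simp: d_def)
  have "X_minus s \<ominus>\<^bsub>P\<^esub> X_minus t = mon d 0"
  proof (rule up_eqI)
    fix k
    have "cf (X_minus s \<ominus>\<^bsub>P\<^esub> X_minus t) k =
      (cf (mon \<one> 1) k \<ominus> cf (mon s 0) k) \<ominus>
      (cf (mon \<one> 1) k \<ominus> cf (mon t 0) k)"
      using assms by (simp add: X_minus_closed del: coeff_monom)
    also have "\<dots> = cf (mon t 0) k \<ominus> cf (mon s 0) k"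
    proof -
      have "cf (mon \<one> 1) k \<in> carrier R" "cf (mon s 0) k \<in> carrier R"
        "cf (mon t 0) k \<in> carrier R" using assms by (auto simp del: coeff_monom)
      then show ?thesis by algebra
    qed
    also have "\<dots> = cf (mon d 0) k" using assms by (simp add: d_def a_minus_def)
    finally show "cf (X_minus s \<ominus>\<^bsub>P\<^esub> X_minus t) k = cf (mon d 0) k" .
  qed (use assms d X_minus_closed in auto)
  moreover have "mon d 0 \<in> Units P"
  proof -
    have cl: "mon d 0 \<in> carrier P" "mon (inv d) 0 \<in> carrier P" using d U by auto
    have "mon d 0 \<otimes>\<^bsub>P\<^esub> mon (inv d) 0 = \<one>\<^bsub>P\<^esub>"
      using U d monom_mult[of d "inv d" 0 0] by (simp add: monom_one)
    then show ?thesis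
      unfolding Units_def using cl P.m_comm[OF cl] by auto
  qed
  ultimately show ?thesis by (simp only:)
qed

lemma deg_nat_pow:
  assumes "p \<in> carrier P" "p \<noteq> \<zero>\<^bsub>P\<^esub>"
  shows "p [^]\<^bsub>P\<^esub> (m::nat) \<noteq> \<zero>\<^bsub>P\<^esub> \<and> deg R (p [^]\<^bsub>P\<^esub> m) = m * deg R p"
proof (induction m)
  case (Suc m)
  then show ?case
    using assms deg_mult[of "p [^]\<^bsub>P\<^esub> m" p] domain.integral[OF UP_domain, of "p [^]\<^bsub>P\<^esub> m" p] by auto
qed simp

text \<open>Split off the power at one point. The powers at the other points still divide the
  cofactor, because the linear factors differ by units, and degrees add over a domain.\<close>

lemma card_times_le_deg:
  assumes "finite S" "S \<subseteq> carrier R" "\<And>s t. s \<in> S \<Longrightarrow> t \<in> S \<Longrightarrow> s \<noteq> t \<Longrightarrow> t \<ominus> s \<in> Units R"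
    and "x \<in> carrier P" "x \<noteq> \<zero>\<^bsub>P\<^esub>"
    and "\<And>s. s \<in> S \<Longrightarrow> X_minus s [^]\<^bsub>P\<^esub> (m::nat) divides\<^bsub>P\<^esub> x"
  shows "card S * m \<le> deg R x"
  using assms
proof (induction S arbitrary: x)
  case (insert s S)
  have s: "s \<in> carrier R" using insert.prems by simp
  note sc = X_minus_closed[OF s] X_minus_nonzero[OF s]
  obtain h where h: "h \<in> carrier P" "x = X_minus s [^]\<^bsub>P\<^esub> m \<otimes>\<^bsub>P\<^esub> h"
    using insert.prems(5)[of s] by (auto simp: factor_def)
  have h0: "h \<noteq> \<zero>\<^bsub>P\<^esub>" using h insert.prems(4) sc by auto
  have "card S * m \<le> deg R h"
  proof (rule insert.IH)
    fix t assume t: "t \<in> S"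
    then have tR: "t \<in> carrier R" using insert.prems by auto
    show "X_minus t [^]\<^bsub>P\<^esub> m divides\<^bsub>P\<^esub> h"
    proof (rule domain.pow_divides_cancel_pow[OF UP_domain])
      show "X_minus t [^]\<^bsub>P\<^esub> m divides\<^bsub>P\<^esub> X_minus s [^]\<^bsub>P\<^esub> m \<otimes>\<^bsub>P\<^esub> h"
        by (subst h(2)[symmetric]) (rule insert.prems(5), simp add: t)
      show "X_minus s \<ominus>\<^bsub>P\<^esub> X_minus t \<in> Units P"
        using s tR t insert.hyps insert.prems(2)[of s t] by (intro X_minus_diff_unit) auto
      show "X_minus s \<in> carrier P" "X_minus t \<in> carrier P" "X_minus t \<noteq> \<zero>\<^bsub>P\<^esub>" "h \<in> carrier P"
        by (fact sc(1) X_minus_closed[OF tR] X_minus_nonzero[OF tR] h(1))+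
    qed
  qed (use insert.prems(1,2) h(1) h0 in \<open>auto simp del: deg_mult\<close>)
  moreover have "deg R x = m + deg R h"
    unfolding h(2) using deg_nat_pow[OF sc, of m] h(1) h0 sc(1) deg_X_minus[OF s]
    by (subst deg_mult) simp_all
  ultimately show ?case using insert.hyps by simp
qed simp

text \<open>A polynomial is represented by its coefficient function, so the quotient is that
  function shifted down by \<open>m\<close>. The shift forgets only the coefficients that
  vanish.\<close>

lemma monom_dvd:
  assumes "p \<in> carrier P" "\<And>k. k < m \<Longrightarrow> cf p k = \<zero>"
  shows "\<exists>h\<in>carrier P. p = mon \<one> m \<otimes>\<^bsub>P\<^esub> h"
proof -
  define h where "h = (\<lambda>k. p (k + m))"
  have carrier_P: "f \<in> carrier P \<longleftrightarrow> f \<in> up R" for f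
    by (simp add: UP_def P_def)
  have cf_P: "cf f k = f k" if "f \<in> up R" for f k
    using that by (simp only: P_def UP_def up_ring.simps restrict_apply if_True)
  have p: "p \<in> up R" using assms(1) carrier_P by simp
  have "h \<in> up R"
  proof (rule mem_upI)
    obtain n where "bound \<zero> n p" using R.bound_upD[OF p] by blast
    then have "bound \<zero> n h" by (simp add: h_def bound_def)
    then show "\<exists>n. bound \<zero> n h" ..
  qed (simp add: h_def mem_upD[OF p])
  then have h: "h \<in> carrier P" and ch: "cf h k = h k" for k
    by (simp_all only: carrier_P cf_P)
  have "p = mon \<one> m \<otimes>\<^bsub>P\<^esub> h"
  proof (rule up_eqI)
    fix k
    show "cf p k = cf (mon \<one> m \<otimes>\<^bsub>P\<^esub> h) k"
    proof (cases "k < m")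
      case True
      have "cf (mon \<one> m \<otimes>\<^bsub>P\<^esub> h) k = (\<Oplus>i\<in>{..k}. \<zero>)"
        using True h unfolding coeff_mult[OF monom_closed[OF R.one_closed] h]
        by (intro R.finsum_cong') auto
      then show ?thesis using True assms by simp
    next
      case False
      then obtain j where "k = j + m" by (metis add.commute le_Suc_ex not_less)
      moreover have "cf (mon \<one> m \<otimes>\<^bsub>P\<^esub> h) (j + m) = \<one> \<otimes> cf h j"
        by (rule coeff_monom_mult[OF R.one_closed h])
      moreover have "\<one> \<otimes> p (j + m) = p (j + m)"
        by (rule R.l_one) (rule mem_upD[OF p])
      moreover have "cf h j = p (j + m)" unfolding ch by (simp only: h_def)
      ultimately show ?thesis using \<open>k = j + m\<close> by (simp only: cf_P[OF p])
    qed
  qed (use assms h in auto)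
  then show ?thesis using h by blast
qed

section \<open>Products of linear forms and their Taylor expansions\<close>

abbreviation lin :: "'a \<times> 'a \<Rightarrow> nat \<Rightarrow> 'a" where
  "lin l \<equiv> mon (fst l) 0 \<oplus>\<^bsub>P\<^esub> mon (snd l) 1"

primrec lin_prod :: "('a \<times> 'a) list \<Rightarrow> nat \<Rightarrow> 'a" where
  "lin_prod [] = \<one>\<^bsub>P\<^esub>"
| "lin_prod (l # ls) = lin l \<otimes>\<^bsub>P\<^esub> lin_prod ls"

lemma lin_prod_closed: "set ls \<subseteq> carrier R \<times> carrier R \<Longrightarrow> lin_prod ls \<in> carrier P"
  by (induction ls) auto

lemma lin_prod_map_closed:
  "(\<And>l. l \<in> set ls \<Longrightarrow> f l \<in> carrier R \<times> carrier R) \<Longrightarrow> lin_prod (map f ls) \<in> carrier P"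
  by (rule lin_prod_closed, unfold set_map, rule image_subsetI)

lemma coeff_lin_mult:
  assumes "l \<in> carrier R \<times> carrier R" "p \<in> carrier P"
  shows "cf (lin l \<otimes>\<^bsub>P\<^esub> p) k =
    fst l \<otimes> cf p k \<oplus> (if k = 0 then \<zero> else snd l \<otimes> cf p (k - 1))"
proof -
  have l: "fst l \<in> carrier R" "snd l \<in> carrier R" using assms by auto
  have "cf (mon (snd l) 1 \<otimes>\<^bsub>P\<^esub> p) k =
      (if k = 0 then \<zero> else snd l \<otimes> cf p (k - 1))"
  proof (cases k)
    case 0
    then show ?thesis using l assms by (subst coeff_mult) auto
  next
    case (Suc j)
    then show ?thesis using coeff_monom_mult[OF l(2) assms(2), of 1 j] by simp
  qed
  then show ?thesis
    using coeff_monom_mult[OF l(1) assms(2), of 0 k] l assms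
    by (subst P.l_distr) (auto simp del: coeff_mult)
qed

lemma coeff_lin_prod_above:
  assumes "set ls \<subseteq> carrier R \<times> carrier R" "length ls < k"
  shows "cf (lin_prod ls) k = \<zero>"
  using assms
proof (induction ls arbitrary: k)
  case (Cons l ls)
  then show ?case
    using coeff_lin_mult[of l "lin_prod ls" k] lin_prod_closed[of ls] by auto
qed auto

lemma coeff_lin_prod_length:
  assumes "set ls \<subseteq> carrier R \<times> carrier R"
  shows "cf (lin_prod ls) (length ls) = foldr (\<lambda>l x. snd l \<otimes> x) ls \<one>"
  using assms
proof (induction ls)
  case (Cons l ls)
  have "cf (lin_prod ls) (Suc (length ls)) = \<zero>"
    using Cons.prems by (intro coeff_lin_prod_above) auto
  moreover have "foldr (\<lambda>l x. snd l \<otimes> x) ls \<one> \<in> carrier R"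
    using Cons.prems by (induction ls) auto
  ultimately show ?case
    using Cons coeff_lin_mult[of l "lin_prod ls" "Suc (length ls)"] lin_prod_closed[of ls] by auto
qed auto

text \<open>The substitution of \<open>X + s\<close> for \<open>X\<close> in \<open>lin l\<close>.
  Coefficient \<open>k\<close> of a product of shifted forms is the \<open>k\<close>-th Taylor
  coefficient of the product at \<open>s\<close>, which measures the order of vanishing in every
  characteristic.\<close>

definition shift :: "'a \<Rightarrow> 'a \<times> 'a \<Rightarrow> 'a \<times> 'a" where
  "shift s l = (fst l \<oplus> s \<otimes> snd l, snd l)"

text \<open>Evaluation at \<open>X - s\<close>, from the universal property of the polynomial ring.
  It inverts the substitution behind \<open>shift s\<close>.\<close>

lemma taylor_hom:
  assumes s: "s \<in> carrier R"
  obtains \<phi> where "ring_hom_cring P P \<phi>" "\<phi> (mon \<one> 1) = X_minus s"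
    "\<And>a. a \<in> carrier R \<Longrightarrow> \<phi> (mon a 0) = mon a 0"
proof -
  interpret UP_pre_univ_prop R P "\<lambda>a. mon a 0" P
    by (intro UP_pre_univ_propI R.is_cring P.is_cring const_ring_hom) (rule P_def)
  show thesis
  proof (rule that)
    show "ring_hom_cring P P (UnivPoly.eval R P (\<lambda>a. mon a 0) (X_minus s))"
      by (intro ring_homD eval_ring_hom X_minus_closed s)
  qed (use eval_monom1 eval_const X_minus_closed[OF s] in auto)
qed

text \<open>Uniqueness in Hermite interpolation: vanishing to order \<open>m\<close> at each
  \<open>s\<close> in \<open>S\<close> makes the combination divisible by the \<open>m\<close>-th
  power of \<open>X_minus s\<close>, and its degree is too small for a nonzero common multiple of
  these powers.\<close>

lemma hermite_lin_prod:
  assumes I: "finite I" and c: "\<And>i. i \<in> I \<Longrightarrow> c i \<in> carrier R"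
    and F: "\<And>i. i \<in> I \<Longrightarrow> set (F i) \<subseteq> carrier R \<times> carrier R"
    and len: "\<And>i. i \<in> I \<Longrightarrow> length (F i) < card S * m"
    and S: "finite S" "S \<subseteq> carrier R" "\<And>s t. s \<in> S \<Longrightarrow> t \<in> S \<Longrightarrow> s \<noteq> t \<Longrightarrow> t \<ominus> s \<in> Units R"
    and van: "\<And>s k. s \<in> S \<Longrightarrow> k < m \<Longrightarrow>
      (\<Oplus>i\<in>I. c i \<otimes> cf (lin_prod (map (shift s) (F i))) k) = \<zero>"
  shows "(\<Oplus>i\<in>I. c i \<otimes> cf (lin_prod (F i)) k) = \<zero>"
proof -
  \<comment> \<open>\<open>G id\<close> is the given combination, and \<open>G (shift s)\<close> is
    its Taylor expansion about \<open>s\<close>.\<close>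
  define G where "G = (\<lambda>f. \<Oplus>\<^bsub>P\<^esub>i\<in>I. c i \<odot>\<^bsub>P\<^esub> lin_prod (map f (F i)))"
  have coeff_G: "cf (G f) k = (\<Oplus>i\<in>I. c i \<otimes> cf (lin_prod (map f (F i))) k)"
    and G_closed: "G f \<in> carrier P"
    if f: "\<And>l. l \<in> carrier R \<times> carrier R \<Longrightarrow> f l \<in> carrier R \<times> carrier R" for f k
  proof -
    have cl: "lin_prod (map f (F i)) \<in> carrier P" if "i \<in> I" for i
      by (rule lin_prod_map_closed, rule f, rule subsetD[OF F[OF that]])
    show "G f \<in> carrier P" unfolding G_def
      using c cl by (intro P.finsum_closed) auto
    show "cf (G f) k = (\<Oplus>i\<in>I. c i \<otimes> cf (lin_prod (map f (F i))) k)"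
      unfolding G_def using c cl I
      by (subst coeff_finsum) (auto intro!: R.finsum_cong')
  qed
  have shift_cl: "shift s l \<in> carrier R \<times> carrier R"
    if "s \<in> S" "l \<in> carrier R \<times> carrier R" for s l
    using that S by (auto simp: shift_def)
  \<comment> \<open>substituting \<open>X - s\<close> for \<open>X\<close> in the expansion at \<open>s\<close> recovers the original polynomial\<close>
  have dvd: "X_minus s [^]\<^bsub>P\<^esub> m divides\<^bsub>P\<^esub> G id" if s: "s \<in> S" for s
  proof -
    have sR: "s \<in> carrier R" using s S by auto
    obtain \<phi> where \<phi>: "ring_hom_cring P P \<phi>" "\<phi> (mon \<one> 1) = X_minus s"
      "\<And>a. a \<in> carrier R \<Longrightarrow> \<phi> (mon a 0) = mon a 0"
      using taylor_hom[OF sR] by blast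
    interpret \<phi>: ring_hom_cring P P \<phi> by (rule \<phi>(1))
    have \<phi>_lin: "\<phi> (lin (shift s l)) = lin l" if l: "l \<in> carrier R \<times> carrier R" for l
    proof -
      obtain a b where ab: "l = (a, b)" "a \<in> carrier R" "b \<in> carrier R" using l by auto
      have m1: "mon b 1 = mon b 0 \<otimes>\<^bsub>P\<^esub> mon \<one> 1"
        using monom_mult[of b \<one> 0 1] ab by simp
      have m2: "mon (a \<oplus> s \<otimes> b) 0 = mon a 0 \<oplus>\<^bsub>P\<^esub> mon s 0 \<otimes>\<^bsub>P\<^esub> mon b 0"
        using monom_mult[of s b 0 0] ab sR by simp
      have "\<phi> (lin (shift s l)) = (mon a 0 \<oplus>\<^bsub>P\<^esub> mon s 0 \<otimes>\<^bsub>P\<^esub> mon b 0) \<oplus>\<^bsub>P\<^esub>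
          mon b 0 \<otimes>\<^bsub>P\<^esub> X_minus s"
        unfolding shift_def ab(1) fst_conv snd_conv m1 m2
        using \<phi>(2,3) ab sR by (simp del: monom_mult One_nat_def)
      also have "\<dots> = mon a 0 \<oplus>\<^bsub>P\<^esub> mon b 0 \<otimes>\<^bsub>P\<^esub> mon \<one> 1"
      proof -
        have "mon a 0 \<in> carrier P" "mon b 0 \<in> carrier P" "mon s 0 \<in> carrier P"
          "mon \<one> 1 \<in> carrier P" using ab sR by auto
        then show ?thesis by algebra
      qed
      finally show ?thesis using m1 ab by simp
    qed
    have \<phi>_prod: "\<phi> (lin_prod (map (shift s) ls)) = lin_prod ls"
      if "set ls \<subseteq> carrier R \<times> carrier R" for ls
      using that
    proof (induction ls)
      case (Cons l ls)
      have l: "l \<in> carrier R \<times> carrier R" and ls: "set ls \<subseteq> carrier R \<times> carrier R"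
        using Cons.prems by simp_all
      have "lin (shift s l) \<in> carrier P"
        using shift_cl[OF s l] by (auto simp: mem_Times_iff)
      moreover have "lin_prod (map (shift s) ls) \<in> carrier P"
        by (rule lin_prod_map_closed, rule shift_cl[OF s], rule subsetD[OF ls])
      ultimately show ?case using Cons.IH[OF ls] \<phi>_lin[OF l] by simp
    qed simp
    have \<phi>_G: "\<phi> (G (shift s)) = G id"
    proof -
      have cl: "lin_prod (map (shift s) (F i)) \<in> carrier P" if "i \<in> I" for i
        by (rule lin_prod_map_closed, rule shift_cl[OF s], rule subsetD[OF F[OF that]])
      have "\<phi> (c i \<odot>\<^bsub>P\<^esub> lin_prod (map (shift s) (F i))) = c i \<odot>\<^bsub>P\<^esub> lin_prod (F i)" if "i \<in> I" for i
        using cl[OF that] c[OF that] F[OF that] \<phi>_prod[of "F i"] \<phi>(3)[of "c i"]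
        by (simp add: monom_mult_is_smult[symmetric] lin_prod_closed)
      moreover have "lin_prod (F i) \<in> carrier P" if "i \<in> I" for i
        using F[OF that] by (rule lin_prod_closed)
      ultimately show ?thesis
        unfolding G_def using cl c
        by (subst \<phi>.hom_finsum) (auto intro!: P.finsum_cong')
    qed
    have "\<exists>h\<in>carrier P. G (shift s) = mon \<one> m \<otimes>\<^bsub>P\<^esub> h"
      using van[OF s] shift_cl[OF s] by (intro monom_dvd) (auto simp: coeff_G G_closed)
    then obtain h where h: "h \<in> carrier P" "G (shift s) = mon \<one> m \<otimes>\<^bsub>P\<^esub> h" by blast
    have "mon \<one> m = mon \<one> 1 [^]\<^bsub>P\<^esub> m" using monom_pow[of \<one> 1 m] by simp
    then have "G id = X_minus s [^]\<^bsub>P\<^esub> m \<otimes>\<^bsub>P\<^esub> \<phi> h"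
      using \<phi>_G h \<phi>(2) by simp
    then show ?thesis using h by (auto simp: factor_def)
  qed
  have Gid: "G id \<in> carrier P" by (rule G_closed) simp
  have coeff_id: "cf (G id) k = (\<Oplus>i\<in>I. c i \<otimes> cf (lin_prod (F i)) k)" for k
    using coeff_G[of id] by simp
  have "G id = \<zero>\<^bsub>P\<^esub>"
  proof (rule ccontr)
    assume nz: "G id \<noteq> \<zero>\<^bsub>P\<^esub>"
    have le: "card S * m \<le> deg R (G id)"
      by (rule card_times_le_deg[OF S Gid nz dvd])
    \<comment> \<open>Every product has degree below \<open>card S * m\<close>, so it contributes
      nothing in the degree of \<open>G id\<close>; the leading coefficient would be zero.\<close>
    have "cf (G id) (deg R (G id)) = (\<Oplus>i\<in>I. \<zero>)"
      unfolding coeff_id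
    proof (intro R.finsum_cong' refl)
      fix i assume "i \<in> I"
      then show "c i \<otimes> cf (lin_prod (F i)) (deg R (G id)) = \<zero>"
        using coeff_lin_prod_above[OF F, of i "deg R (G id)"] len[of i] le c by auto
    qed auto
    then have "cf (G id) (deg R (G id)) = \<zero>" by simp
    then show False using lcoeff_nonzero[OF nz Gid] by simp
  qed
  then show ?thesis using coeff_id[of k] by simp
qed

end

section \<open>Products of affine forms in several variables\<close>

lemma (in abelian_monoid) finsum_swap:
  assumes "finite A" "finite B" "\<And>i j. i \<in> A \<Longrightarrow> j \<in> B \<Longrightarrow> f i j \<in> carrier G"
  shows "(\<Oplus>i\<in>A. \<Oplus>j\<in>B. f i j) = (\<Oplus>j\<in>B. \<Oplus>i\<in>A. f i j)"
  using assms(1,3)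
proof (induction A)
  case empty
  show ?case by simp
next
  case (insert a A)
  have "(\<Oplus>i\<in>insert a A. \<Oplus>j\<in>B. f i j) = (\<Oplus>j\<in>B. f a j) \<oplus> (\<Oplus>j\<in>B. \<Oplus>i\<in>A. f i j)"
    using insert by (subst finsum_insert) (auto intro!: finsum_closed)
  also have "\<dots> = (\<Oplus>j\<in>B. f a j \<oplus> (\<Oplus>i\<in>A. f i j))"
    using insert by (intro finsum_addf[symmetric]) (auto intro!: finsum_closed)
  also have "\<dots> = (\<Oplus>j\<in>B. \<Oplus>i\<in>insert a A. f i j)"
    using insert by (intro finsum_cong' refl) (auto intro!: finsum_closed)
  finally show ?case .
qed

section \<open>Multi-indices and expansion along a direction\<close>

definition exponents :: "nat \<Rightarrow> nat \<Rightarrow> (nat \<Rightarrow> nat) set" where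
  "exponents r k = {\<alpha> \<in> {..<r} \<rightarrow>\<^sub>E UNIV. sum \<alpha> {..<r} = k}"

lemma exponents_subset_box: "k < m \<Longrightarrow> exponents r k \<subseteq> {..<r} \<rightarrow>\<^sub>E {..<m}"
proof (intro subsetI)
  fix \<alpha> assume k: "k < m" and \<alpha>: "\<alpha> \<in> exponents r k"
  have "\<alpha> i \<le> k" if "i < r" for i
    using \<alpha> that member_le_sum[of i "{..<r}" \<alpha>] by (auto simp: exponents_def)
  then show "\<alpha> \<in> {..<r} \<rightarrow>\<^sub>E {..<m}"
    using \<alpha> k by (force simp: exponents_def PiE_iff)
qed

lemma finite_exponents: "finite (exponents r k)"
  by (rule finite_subset[OF exponents_subset_box[of k "Suc k"]]) (auto intro: finite_PiE)

lemma exponents_0: "exponents r 0 = {\<lambda>i\<in>{..<r}. 0}"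
  by (auto simp: exponents_def PiE_iff extensional_def fun_eq_iff)

text \<open>Raising exponent \<open>i\<close> corresponds to multiplying a monomial by the variable
  \<open>w i\<close>. The bijection reindexes sums over monomials that contain this
  variable.\<close>

lemma bij_betw_exponents_Suc:
  assumes "i < r"
  shows "bij_betw (\<lambda>\<alpha>. \<alpha>(i := Suc (\<alpha> i))) (exponents r k) {\<alpha> \<in> exponents r (Suc k). 0 < \<alpha> i}"
proof (rule bij_betw_byWitness[where f' = "\<lambda>\<alpha>. \<alpha>(i := \<alpha> i - 1)"])
  have sum_upd: "sum (\<alpha>(i := x)) {..<r} = x + sum \<alpha> ({..<r} - {i})"
    and sum_split: "sum \<alpha> {..<r} = \<alpha> i + sum \<alpha> ({..<r} - {i})" for \<alpha> :: "nat \<Rightarrow> nat" and x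
    using assms by (auto simp: sum.remove[of "{..<r}" i])
  have ext: "\<alpha>(i := x) \<in> {..<r} \<rightarrow>\<^sub>E UNIV" if "\<alpha> \<in> {..<r} \<rightarrow>\<^sub>E UNIV" for \<alpha> :: "nat \<Rightarrow> nat" and x
    using that assms by (auto simp: PiE_iff extensional_def)
  show "(\<lambda>\<alpha>. \<alpha>(i := Suc (\<alpha> i))) ` exponents r k \<subseteq> {\<alpha> \<in> exponents r (Suc k). 0 < \<alpha> i}"
    using ext by (auto simp: exponents_def sum_upd sum_split)
  show "(\<lambda>\<alpha>. \<alpha>(i := \<alpha> i - 1)) ` {\<alpha> \<in> exponents r (Suc k). 0 < \<alpha> i} \<subseteq> exponents r k"
    using ext by (auto simp: exponents_def sum_upd sum_split)
qed auto

context cring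
begin

definition monomial :: "nat \<Rightarrow> (nat \<Rightarrow> 'a) \<Rightarrow> (nat \<Rightarrow> nat) \<Rightarrow> 'a" where
  "monomial r w \<alpha> = (\<Otimes>i\<in>{..<r}. w i [^] \<alpha> i)"

lemma monomial_closed: "w \<in> {..<r} \<rightarrow> carrier R \<Longrightarrow> monomial r w \<alpha> \<in> carrier R"
  unfolding monomial_def by (intro finprod_closed) auto

lemma monomial_0: "w \<in> {..<r} \<rightarrow> carrier R \<Longrightarrow> monomial r w (\<lambda>i\<in>{..<r}. 0) = \<one>"
  unfolding monomial_def by (subst finprod_cong'[of _ "{..<r}" "\<lambda>_. \<one>"]) auto

lemma monomial_Suc:
  assumes "w \<in> {..<r} \<rightarrow> carrier R" "i < r"
  shows "monomial r w (\<alpha>(i := Suc (\<alpha> i))) = w i \<otimes> monomial r w \<alpha>"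
proof -
  have ins: "{..<r} = insert i ({..<r} - {i})" using assms(2) by auto
  have wi: "w i \<in> carrier R" using assms by auto
  let ?r = "\<Otimes>j\<in>{..<r} - {i}. w j [^] \<alpha> j"
  have r: "?r \<in> carrier R" using assms by (intro finprod_closed) auto
  have "monomial r w (\<alpha>(i := Suc (\<alpha> i))) = w i [^] Suc (\<alpha> i) \<otimes> (\<Otimes>j\<in>{..<r} - {i}. w j [^] (\<alpha>(i := Suc (\<alpha> i))) j)"
    unfolding monomial_def using assms by (subst ins, subst finprod_insert) auto
  also have "(\<Otimes>j\<in>{..<r} - {i}. w j [^] (\<alpha>(i := Suc (\<alpha> i))) j) = ?r"
    using assms by (intro finprod_cong') auto
  finally have 1: "monomial r w (\<alpha>(i := Suc (\<alpha> i))) = w i [^] Suc (\<alpha> i) \<otimes> ?r" .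
  have 2: "monomial r w \<alpha> = w i [^] \<alpha> i \<otimes> ?r"
    unfolding monomial_def using assms by (subst ins, subst finprod_insert) auto
  show ?thesis unfolding 1 2 using wi r by (simp add: m_ac)
qed

text \<open>
  \<open>mcoeff r ls \<alpha>\<close> is the coefficient of \<open>w\<^sup>\<alpha>\<close> in the product of the affine forms
  \<open>a + (\<Sum>i<r. b i w\<^sub>i)\<close>, \<open>(a, b)\<close> in \<open>ls\<close>.
\<close>

primrec mcoeff :: "nat \<Rightarrow> ('a \<times> (nat \<Rightarrow> 'a)) list \<Rightarrow> (nat \<Rightarrow> nat) \<Rightarrow> 'a" where
  "mcoeff r [] \<alpha> = (if \<alpha> = (\<lambda>i\<in>{..<r}. 0) then \<one> else \<zero>)"
| "mcoeff r (l # ls) \<alpha> = fst l \<otimes> mcoeff r ls \<alpha> \<oplus>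
    (\<Oplus>i\<in>{..<r}. if 0 < \<alpha> i then snd l i \<otimes> mcoeff r ls (\<alpha>(i := \<alpha> i - 1)) else \<zero>)"

abbreviation affine_forms :: "nat \<Rightarrow> ('a \<times> (nat \<Rightarrow> 'a)) set" where
  "affine_forms r \<equiv> carrier R \<times> ({..<r} \<rightarrow> carrier R)"

lemma mcoeff_closed: "set ls \<subseteq> affine_forms r \<Longrightarrow> mcoeff r ls \<alpha> \<in> carrier R"
proof (induction ls arbitrary: \<alpha>)
  case (Cons l ls)
  then have "mcoeff r ls \<beta> \<in> carrier R" for \<beta> by simp
  moreover have "fst l \<in> carrier R" "snd l \<in> {..<r} \<rightarrow> carrier R" using Cons.prems by auto
  ultimately show ?case by (auto intro!: a_closed finsum_closed m_closed)
qed simp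

text \<open>Replacing the variables by \<open>X\<close> times \<open>w\<close> turns the affine form
  into a univariate one, returned as a pair that \<open>lin\<close> accepts.\<close>

definition at_dir :: "nat \<Rightarrow> (nat \<Rightarrow> 'a) \<Rightarrow> 'a \<times> (nat \<Rightarrow> 'a) \<Rightarrow> 'a \<times> 'a" where
  "at_dir r w l = (fst l, \<Oplus>i\<in>{..<r}. snd l i \<otimes> w i)"

end

text \<open>Under the substitution of \<open>X\<close> times \<open>w\<close>, a monomial of total
  degree \<open>k\<close> becomes its value at \<open>w\<close> times \<open>X^k\<close>, so each
  coefficient collects the monomials of one total degree. The induction matches the recursion of
  \<open>mcoeff\<close> with \<open>coeff_lin_mult\<close>.\<close>

lemma (in UP_domain) coeff_lin_prod_at_dir:
  assumes "set ls \<subseteq> R.affine_forms r" and w: "w \<in> {..<r} \<rightarrow> carrier R"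
  shows "cf (lin_prod (map (R.at_dir r w) ls)) k =
    (\<Oplus>\<alpha>\<in>exponents r k. R.mcoeff r ls \<alpha> \<otimes> R.monomial r w \<alpha>)"
  using assms(1)
proof (induction ls arbitrary: k)
  case Nil
  show ?case
  proof (cases k)
    case 0
    then show ?thesis using R.monomial_0[OF w] by (simp add: exponents_0)
  next
    case (Suc j)
    have "(\<Oplus>\<alpha>\<in>exponents r k. R.mcoeff r [] \<alpha> \<otimes> R.monomial r w \<alpha>) = (\<Oplus>\<alpha>\<in>exponents r k. \<zero>)"
      using Suc w by (intro R.finsum_cong') (auto simp: exponents_def R.monomial_closed)
    then show ?thesis using Suc by simp
  qed
next
  case (Cons l ls)
  obtain a b where l: "l = (a, b)" "a \<in> carrier R" "b \<in> {..<r} \<rightarrow> carrier R"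
    using Cons.prems by auto
  have ls: "set ls \<subseteq> R.affine_forms r" using Cons.prems by simp
  note cl = R.mcoeff_closed[OF ls] R.monomial_closed[OF w]
  define S where "S = (\<lambda>k. \<Oplus>\<alpha>\<in>exponents r k. R.mcoeff r ls \<alpha> \<otimes> R.monomial r w \<alpha>)"
  have bw: "b i \<in> carrier R" "w i \<in> carrier R" if "i < r" for i using that l w by auto
  have S: "S k \<in> carrier R" for k unfolding S_def using cl by (intro R.finsum_closed) auto
  let ?B = "\<Oplus>i\<in>{..<r}. b i \<otimes> w i"
  have B: "?B \<in> carrier R" using l w by (intro R.finsum_closed) auto
  define T where "T = (\<lambda>i \<alpha>. if 0 < \<alpha> i then b i \<otimes> R.mcoeff r ls (\<alpha>(i := \<alpha> i - 1)) else \<zero>)"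
  have T: "T i \<alpha> \<in> carrier R" if "i < r" for i \<alpha>
    using that l cl by (auto simp: T_def)
  \<comment> \<open>Only monomials that contain variable \<open>i\<close> contribute. Dividing them
    by it gives all monomials of degree \<open>k - 1\<close>, with \<open>b i \<otimes> w i\<close>
    pulled out.\<close>
  have T_sum: "(\<Oplus>\<alpha>\<in>exponents r k. T i \<alpha> \<otimes> R.monomial r w \<alpha>) =
      (if k = 0 then \<zero> else b i \<otimes> w i \<otimes> S (k - 1))" if i: "i < r" for i
  proof (cases k)
    case 0
    then show ?thesis using i cl by (simp add: exponents_0 T_def)
  next
    case (Suc j)
    note bw = bw[OF i]
    let ?f = "\<lambda>\<alpha>. T i \<alpha> \<otimes> R.monomial r w \<alpha>"
    note bij = bij_betw_exponents_Suc[OF i, of j]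
    have "(\<Oplus>\<alpha>\<in>exponents r k. ?f \<alpha>) = (\<Oplus>\<alpha>\<in>{\<alpha> \<in> exponents r (Suc j). 0 < \<alpha> i}. ?f \<alpha>)"
      using T[OF i] cl Suc finite_exponents
      by (intro R.add.finprod_mono_neutral_cong_right) (auto simp: T_def)
    also have "\<dots> = (\<Oplus>\<alpha>\<in>exponents r j. ?f (\<alpha>(i := Suc (\<alpha> i))))"
      unfolding bij_betw_imp_surj_on[OF bij, symmetric]
      using bij T[OF i] cl by (intro R.finsum_reindex) (auto simp: bij_betw_def)
    also have "\<dots> = (\<Oplus>\<alpha>\<in>exponents r j. b i \<otimes> w i \<otimes> (R.mcoeff r ls \<alpha> \<otimes> R.monomial r w \<alpha>))"
    proof (intro R.finsum_cong' refl)
      fix \<alpha>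
      show "?f (\<alpha>(i := Suc (\<alpha> i))) = b i \<otimes> w i \<otimes> (R.mcoeff r ls \<alpha> \<otimes> R.monomial r w \<alpha>)"
        unfolding R.monomial_Suc[OF w i] using bw cl by (simp add: T_def R.m_ac)
    qed (use bw cl in auto)
    also have "\<dots> = b i \<otimes> w i \<otimes> S j"
      unfolding S_def using bw cl finite_exponents by (intro R.finsum_rdistr[symmetric]) auto
    finally show ?thesis using Suc by simp
  qed
  have "(\<Oplus>\<alpha>\<in>exponents r k. R.mcoeff r (l # ls) \<alpha> \<otimes> R.monomial r w \<alpha>) =
    (\<Oplus>\<alpha>\<in>exponents r k. a \<otimes> (R.mcoeff r ls \<alpha> \<otimes> R.monomial r w \<alpha>) \<oplus>
       (\<Oplus>i\<in>{..<r}. T i \<alpha> \<otimes> R.monomial r w \<alpha>))"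
  proof (intro R.finsum_cong' refl)
    fix \<alpha>
    have "(\<Oplus>i\<in>{..<r}. T i \<alpha>) \<in> carrier R" using T by (intro R.finsum_closed) auto
    moreover have "(\<Oplus>i\<in>{..<r}. T i \<alpha>) \<otimes> R.monomial r w \<alpha> = (\<Oplus>i\<in>{..<r}. T i \<alpha> \<otimes> R.monomial r w \<alpha>)"
      using T cl by (intro R.finsum_ldistr) auto
    moreover have "R.mcoeff r (l # ls) \<alpha> = a \<otimes> R.mcoeff r ls \<alpha> \<oplus> (\<Oplus>i\<in>{..<r}. T i \<alpha>)"
      by (simp only: R.mcoeff.simps T_def l(1) fst_conv snd_conv)
    ultimately show "R.mcoeff r (l # ls) \<alpha> \<otimes> R.monomial r w \<alpha> =
        a \<otimes> (R.mcoeff r ls \<alpha> \<otimes> R.monomial r w \<alpha>) \<oplus> (\<Oplus>i\<in>{..<r}. T i \<alpha> \<otimes> R.monomial r w \<alpha>)"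
      using l(2) cl by (simp add: R.l_distr R.m_assoc)
  qed (use l cl T in \<open>auto intro!: R.a_closed R.finsum_closed\<close>)
  also have "\<dots> = (\<Oplus>\<alpha>\<in>exponents r k. a \<otimes> (R.mcoeff r ls \<alpha> \<otimes> R.monomial r w \<alpha>)) \<oplus>
      (\<Oplus>\<alpha>\<in>exponents r k. \<Oplus>i\<in>{..<r}. T i \<alpha> \<otimes> R.monomial r w \<alpha>)"
    using l cl T by (intro R.finsum_addf) (auto intro!: R.finsum_closed)
  also have "(\<Oplus>\<alpha>\<in>exponents r k. a \<otimes> (R.mcoeff r ls \<alpha> \<otimes> R.monomial r w \<alpha>)) = a \<otimes> S k"
    unfolding S_def using l cl finite_exponents by (intro R.finsum_rdistr[symmetric]) auto
  also have "(\<Oplus>\<alpha>\<in>exponents r k. \<Oplus>i\<in>{..<r}. T i \<alpha> \<otimes> R.monomial r w \<alpha>) =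
      (\<Oplus>i\<in>{..<r}. \<Oplus>\<alpha>\<in>exponents r k. T i \<alpha> \<otimes> R.monomial r w \<alpha>)"
    using T cl finite_exponents by (intro R.finsum_swap) auto
  also have "\<dots> = (\<Oplus>i\<in>{..<r}. if k = 0 then \<zero> else b i \<otimes> w i \<otimes> S (k - 1))"
    using T_sum bw S by (intro R.finsum_cong') auto
  also have "\<dots> = (if k = 0 then \<zero> else ?B \<otimes> S (k - 1))"
    using S bw by (cases "k = 0") (auto intro!: R.finsum_ldistr[symmetric])
  finally have *: "(\<Oplus>\<alpha>\<in>exponents r k. R.mcoeff r (l # ls) \<alpha> \<otimes> R.monomial r w \<alpha>) =
      a \<otimes> S k \<oplus> (if k = 0 then \<zero> else ?B \<otimes> S (k - 1))" .
  have IH: "cf (lin_prod (map (R.at_dir r w) ls)) k' = S k'" for k'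
    using Cons.IH[OF ls] by (simp add: S_def)
  have at: "R.at_dir r w l = (a, ?B)" by (simp add: R.at_dir_def l)
  have cl': "lin_prod (map (R.at_dir r w) ls) \<in> carrier P"
  proof (rule lin_prod_map_closed)
    fix l' assume "l' \<in> set ls"
    then have "fst l' \<in> carrier R" "snd l' \<in> {..<r} \<rightarrow> carrier R"
      using subsetD[OF ls] by (auto simp: mem_Times_iff)
    then show "R.at_dir r w l' \<in> carrier R \<times> carrier R"
      using bw by (auto simp: R.at_dir_def intro!: R.finsum_closed)
  qed
  have "cf (lin_prod (map (R.at_dir r w) (l # ls))) k = a \<otimes> S k \<oplus> (if k = 0 then \<zero> else ?B \<otimes> S (k - 1))"
    unfolding list.map lin_prod.simps at
    using coeff_lin_mult[of "(a, ?B)" "lin_prod (map (R.at_dir r w) ls)" k] l(2) B cl'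
    by (simp only: IH fst_conv snd_conv mem_Sigma_iff)
  then show ?case using * by simp
qed

text \<open>A monomial of total degree below \<open>m\<close> has every exponent below
  \<open>m\<close>, so the conditions on the box force vanishing to order \<open>m\<close> at the
  origin in every direction. The box has exactly \<open>m ^ r\<close> elements.\<close>

lemma (in UP_domain) coeff_combination_eq_0:
  assumes I: "finite I" and c: "\<And>i. i \<in> I \<Longrightarrow> c i \<in> carrier R"
    and F: "\<And>i. i \<in> I \<Longrightarrow> set (F i) \<subseteq> R.affine_forms r"
    and w: "w \<in> {..<r} \<rightarrow> carrier R"
    and van: "\<And>\<alpha>. \<alpha> \<in> {..<r} \<rightarrow>\<^sub>E {..<m} \<Longrightarrow> (\<Oplus>i\<in>I. c i \<otimes> R.mcoeff r (F i) \<alpha>) = \<zero>"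
    and "k < m"
  shows "(\<Oplus>i\<in>I. c i \<otimes> cf (lin_prod (map (R.at_dir r w) (F i))) k) = \<zero>"
proof -
  note cl = R.mcoeff_closed[OF F] R.monomial_closed[OF w] c
  have "(\<Oplus>i\<in>I. c i \<otimes> cf (lin_prod (map (R.at_dir r w) (F i))) k) =
      (\<Oplus>i\<in>I. \<Oplus>\<alpha>\<in>exponents r k. c i \<otimes> R.mcoeff r (F i) \<alpha> \<otimes> R.monomial r w \<alpha>)"
  proof (intro R.finsum_cong' refl)
    fix i assume i: "i \<in> I"
    have "c i \<otimes> cf (lin_prod (map (R.at_dir r w) (F i))) k =
        c i \<otimes> (\<Oplus>\<alpha>\<in>exponents r k. R.mcoeff r (F i) \<alpha> \<otimes> R.monomial r w \<alpha>)"
      using coeff_lin_prod_at_dir[OF F[OF i] w] by simp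
    also have "\<dots> = (\<Oplus>\<alpha>\<in>exponents r k. c i \<otimes> (R.mcoeff r (F i) \<alpha> \<otimes> R.monomial r w \<alpha>))"
      using cl i finite_exponents by (intro R.finsum_rdistr) auto
    also have "\<dots> = (\<Oplus>\<alpha>\<in>exponents r k. c i \<otimes> R.mcoeff r (F i) \<alpha> \<otimes> R.monomial r w \<alpha>)"
      using cl i by (intro R.finsum_cong') (auto simp: R.m_assoc)
    finally show "c i \<otimes> cf (lin_prod (map (R.at_dir r w) (F i))) k =
        (\<Oplus>\<alpha>\<in>exponents r k. c i \<otimes> R.mcoeff r (F i) \<alpha> \<otimes> R.monomial r w \<alpha>)" .
  qed (use cl in \<open>auto intro!: R.finsum_closed\<close>)
  also have "\<dots> = (\<Oplus>\<alpha>\<in>exponents r k. \<Oplus>i\<in>I. c i \<otimes> R.mcoeff r (F i) \<alpha> \<otimes> R.monomial r w \<alpha>)"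
    using I finite_exponents cl by (intro R.finsum_swap) auto
  also have "\<dots> = (\<Oplus>\<alpha>\<in>exponents r k. \<zero>)"
  proof (intro R.finsum_cong' refl)
    fix \<alpha> assume \<alpha>: "\<alpha> \<in> exponents r k"
    have "(\<Oplus>i\<in>I. c i \<otimes> R.mcoeff r (F i) \<alpha> \<otimes> R.monomial r w \<alpha>) =
        (\<Oplus>i\<in>I. c i \<otimes> R.mcoeff r (F i) \<alpha>) \<otimes> R.monomial r w \<alpha>"
      using I cl by (intro R.finsum_ldistr[symmetric]) auto
    then show "(\<Oplus>i\<in>I. c i \<otimes> R.mcoeff r (F i) \<alpha> \<otimes> R.monomial r w \<alpha>) = \<zero>"
      using van[OF subsetD[OF exponents_subset_box[OF \<open>k < m\<close>] \<alpha>]] cl by simp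
  qed auto
  finally show ?thesis by simp
qed

section \<open>The counting argument\<close>

text \<open>Pigeonhole: there are more coefficient vectors than value vectors, so two of them share
  an image, and their difference is a nonzero kernel vector.\<close>

lemma (in field) exists_kernel_vector:
  assumes fin: "finite (carrier R)" "finite I" "finite J" and less: "card J < card I"
    and T: "\<And>i j. i \<in> I \<Longrightarrow> j \<in> J \<Longrightarrow> T j i \<in> carrier R"
  shows "\<exists>c\<in>I \<rightarrow> carrier R. (\<exists>i\<in>I. c i \<noteq> \<zero>) \<and> (\<forall>j\<in>J. (\<Oplus>i\<in>I. c i \<otimes> T j i) = \<zero>)"
proof -
  define f where "f = (\<lambda>c. \<lambda>j\<in>J. \<Oplus>i\<in>I. c i \<otimes> T j i)"
  have "card {\<zero>, \<one>} \<le> card (carrier R)"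
    using fin by (intro card_mono) auto
  then have "1 < card (carrier R)" by simp
  then have "card (J \<rightarrow>\<^sub>E carrier R) < card (I \<rightarrow>\<^sub>E carrier R)"
    using less fin by (simp add: card_PiE)
  moreover have "f ` (I \<rightarrow>\<^sub>E carrier R) \<subseteq> J \<rightarrow>\<^sub>E carrier R"
    unfolding f_def using T
    by (intro image_subsetI restrict_PiE_iff[THEN iffD2] ballI finsum_closed Pi_I m_closed) (auto simp: PiE_iff)
  then have "card (f ` (I \<rightarrow>\<^sub>E carrier R)) \<le> card (J \<rightarrow>\<^sub>E carrier R)"
    using fin by (intro card_mono finite_PiE) auto
  ultimately have "\<not> inj_on f (I \<rightarrow>\<^sub>E carrier R)"
    by (intro pigeonhole) simp
  then obtain c d where cd: "c \<in> I \<rightarrow>\<^sub>E carrier R" "d \<in> I \<rightarrow>\<^sub>E carrier R" "f c = f d" "c \<noteq> d"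
    by (auto simp: inj_on_def)
  have cl: "c i \<in> carrier R" "d i \<in> carrier R" if "i \<in> I" for i
    using cd that by auto
  obtain i where i: "i \<in> I" "c i \<noteq> d i"
    using cd PiE_ext by metis
  show ?thesis
  proof (intro bexI[of _ "\<lambda>i. c i \<ominus> d i"] conjI ballI)
    show "\<exists>i\<in>I. c i \<ominus> d i \<noteq> \<zero>" using i cl by auto
    fix j assume j: "j \<in> J"
    let ?s = "\<lambda>c. \<Oplus>i\<in>I. c i \<otimes> T j i"
    have sc: "?s c \<in> carrier R" "?s d \<in> carrier R" "?s (\<lambda>i. c i \<ominus> d i) \<in> carrier R"
      using cl T j by (auto intro!: finsum_closed)
    have "?s (\<lambda>i. c i \<ominus> d i) \<oplus> ?s d = (\<Oplus>i\<in>I. (c i \<ominus> d i) \<otimes> T j i \<oplus> d i \<otimes> T j i)"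
      using cl T j by (intro finsum_addf[symmetric]) auto
    also have "\<dots> = ?s c"
    proof (intro finsum_cong' refl)
      fix i assume "i \<in> I"
      then have "c i \<in> carrier R" "d i \<in> carrier R" "T j i \<in> carrier R" using cl T j by auto
      then show "(c i \<ominus> d i) \<otimes> T j i \<oplus> d i \<otimes> T j i = c i \<otimes> T j i" by algebra
    qed (use cl T j in auto)
    also have "\<dots> = ?s d" using fun_cong[OF cd(3), of j] j by (simp add: f_def)
    finally show "?s (\<lambda>i. c i \<ominus> d i) = \<zero>" using sc by simp
  qed (use cl in auto)
qed

text \<open>
  Here \<open>\<phi> p f\<close> is the expansion of the linear form \<open>f\<close> along the contact hyperplane at \<open>p\<close>, \<open>g \<theta> f\<close>
  is its restriction to the line of \<open>\<theta>\<close>, and the product of the forms in \<open>F \<theta> e\<close> has degree \<open>d + e\<close>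
  and separates \<open>\<theta>\<close> from the other directions. The unknown polynomial is a combination of these
  \<open>N |\<Omega>|\<close> products.
\<close>

lemma (in UP_domain) multiplicity_bound:
  fixes \<phi> :: "'p \<Rightarrow> 'f \<Rightarrow> 'a \<times> (nat \<Rightarrow> 'a)" and g :: "'i \<Rightarrow> 'f \<Rightarrow> 'a \<times> 'a"
  assumes fld: "field R" and fin: "finite (carrier R)" "finite \<Omega>" "finite E"
    and \<phi>: "\<And>p \<theta> e. p \<in> E \<Longrightarrow> \<theta> \<in> \<Omega> \<Longrightarrow> \<phi> p ` set (F \<theta> e) \<subseteq> R.affine_forms r"
    and g: "\<And>\<theta> \<theta>' e. \<theta> \<in> \<Omega> \<Longrightarrow> \<theta>' \<in> \<Omega> \<Longrightarrow> g \<theta> ` set (F \<theta>' e) \<subseteq> carrier R \<times> carrier R"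
    and w: "\<And>\<theta>. \<theta> \<in> \<Omega> \<Longrightarrow> w \<theta> \<in> {..<r} \<rightarrow> carrier R"
    and S: "\<And>\<theta>. \<theta> \<in> \<Omega> \<Longrightarrow> S \<theta> \<subseteq> carrier R" "\<And>\<theta>. \<theta> \<in> \<Omega> \<Longrightarrow> l \<le> card (S \<theta>)"
    and pt: "\<And>\<theta> s. \<theta> \<in> \<Omega> \<Longrightarrow> s \<in> S \<theta> \<Longrightarrow> pt \<theta> s \<in> E"
    and at_pt: "\<And>\<theta> \<theta>' s e f. \<theta> \<in> \<Omega> \<Longrightarrow> \<theta>' \<in> \<Omega> \<Longrightarrow> s \<in> S \<theta> \<Longrightarrow> f \<in> set (F \<theta>' e) \<Longrightarrow>
      R.at_dir r (w \<theta>) (\<phi> (pt \<theta> s) f) = shift s (g \<theta> f)"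
    and len: "\<And>\<theta> e. \<theta> \<in> \<Omega> \<Longrightarrow> length (F \<theta> e) = d + e" "d + N \<le> l * m"
    and vanish: "\<And>\<theta> \<theta>' e. \<theta> \<in> \<Omega> \<Longrightarrow> \<theta>' \<in> \<Omega> \<Longrightarrow>
      foldr (\<lambda>f x. snd (g \<theta> f) \<otimes> x) (F \<theta>' e) \<one> = \<zero> \<longleftrightarrow> \<theta> \<noteq> \<theta>'"
  shows "N * card \<Omega> \<le> card E * m ^ r"
proof (rule ccontr)
  assume less: "\<not> N * card \<Omega> \<le> card E * m ^ r"
  \<comment> \<open>The unknowns are the coefficients of the \<open>N * card \<Omega>\<close>
    products; the equations kill the box coefficients at each point of \<open>E\<close>. If the
    bound fails, there are fewer equations than unknowns.\<close>
  let ?I = "\<Omega> \<times> {..<N}" and ?J = "E \<times> ({..<r} \<rightarrow>\<^sub>E {..<m})"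
  define T where "T = (\<lambda>j i. R.mcoeff r (map (\<phi> (fst j)) (F (fst i) (snd i))) (snd j))"
  have card_less: "card ?J < card ?I"
    using less fin by (simp add: card_cartesian_product card_PiE mult.commute)
  have T_closed: "T j i \<in> carrier R" if "i \<in> ?I" "j \<in> ?J" for i j
    unfolding T_def using that \<phi>[of "fst j" "fst i" "snd i"]
    by (intro R.mcoeff_closed) (simp add: mem_Times_iff)
  have finIJ: "finite ?I" "finite ?J" using fin by (auto intro: finite_PiE)
  have "\<exists>c\<in>?I \<rightarrow> carrier R. (\<exists>i\<in>?I. c i \<noteq> \<zero>) \<and> (\<forall>j\<in>?J. (\<Oplus>i\<in>?I. c i \<otimes> T j i) = \<zero>)"
    (is "\<exists>c\<in>_. ?nz c \<and> ?ker c")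
    by (rule field.exists_kernel_vector[OF fld fin(1) finIJ card_less]) (rule T_closed)
  then obtain c where c_fun: "c \<in> ?I \<rightarrow> carrier R" and c_nz_ker: "?nz c \<and> ?ker c" ..
  note c_nz = conjunct1[OF c_nz_ker] and c_ker = conjunct2[OF c_nz_ker]
  have c: "c i \<in> carrier R" if "i \<in> ?I" for i using c_fun that by (rule funcset_mem)
  \<comment> \<open>on the line of \<open>\<theta>\<close> only the products of maximal degree contribute to the leading term\<close>
  define M where "M = {e. \<exists>\<theta>\<in>\<Omega>. e < N \<and> c (\<theta>, e) \<noteq> \<zero>}"
  have "M \<subseteq> {..<N}" by (auto simp: M_def)
  then have finM: "finite M" by (rule finite_subset) simp
  have "M \<noteq> {}" using c_nz by (auto simp: M_def)
  then have "Max M \<in> M" using finM by simp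
  then obtain \<theta> where \<theta>: "\<theta> \<in> \<Omega>" "Max M < N" "c (\<theta>, Max M) \<noteq> \<zero>" by (auto simp: M_def)
  define e where "e = Max M"
  have e: "e < N" "c (\<theta>, e) \<noteq> \<zero>" using \<theta> by (auto simp: e_def)
  have above: "c (\<theta>', e') = \<zero>" if "\<theta>' \<in> \<Omega>" "e' < N" "e < e'" for \<theta>' e'
  proof (rule ccontr)
    assume "c (\<theta>', e') \<noteq> \<zero>"
    then have "e' \<in> M" using that by (auto simp: M_def)
    then have "e' \<le> e" using finM by (simp add: e_def)
    then show False using that by simp
  qed
  define G where "G = (\<lambda>i. map (g \<theta>) (F (fst i) (snd i)))"
  have G: "set (G i) \<subseteq> carrier R \<times> carrier R" if "i \<in> ?I" for i
    using that g[OF \<theta>(1), of "fst i" "snd i"] by (simp add: G_def mem_Times_iff)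
  have lenG: "length (G i) = d + snd i" if "i \<in> ?I" for i
    using that len(1) by (simp add: G_def mem_Times_iff)
  have finS: "finite (S \<theta>)" using S(1)[OF \<theta>(1)] fin(1) by (rule finite_subset)
  \<comment> \<open>Restricted to the line of \<theta>, the combination has degree below
    \<open>d + N\<close>, which is at most \<open>l * m\<close>, and it vanishes to order
    \<open>m\<close> at no fewer than \<open>l\<close> parameters.\<close>
  have zero: "(\<Oplus>i\<in>?I. c i \<otimes> cf (lin_prod (G i)) k) = \<zero>" for k
  proof (rule hermite_lin_prod[where S = "S \<theta>" and m = m])
    have le: "l * m \<le> card (S \<theta>) * m" using S(2)[OF \<theta>(1)] by (rule mult_le_mono1)
    show "length (G i) < card (S \<theta>) * m" if "i \<in> ?I" for i
    proof -
      have "snd i < N" using that by auto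
      then show ?thesis
        using lenG[OF that] len(2) le by linarith
    qed
    show "t \<ominus> s \<in> Units R" if "s \<in> S \<theta>" "t \<in> S \<theta>" "s \<noteq> t" for s t
    proof -
      have "s \<in> carrier R" "t \<in> carrier R" using that S(1)[OF \<theta>(1)] by auto
      then show ?thesis using \<open>s \<noteq> t\<close> field.field_Units[OF fld] by simp
    qed
    fix s k assume s: "s \<in> S \<theta>" and k: "k < m"
    have sR: "s \<in> carrier R" using s S(1)[OF \<theta>(1)] by auto
    note p = pt[OF \<theta>(1) s]
    \<comment> \<open>By \<open>at_pt\<close>, expanding the restricted product at parameter
      \<open>s\<close> is the same as reading the contact expansion at \<open>pt \<theta> s\<close>
      in the direction \<open>w \<theta>\<close>. This carries the equations at points over to the
      line.\<close>
    have eq: "map (shift s) (G i) = map (R.at_dir r (w \<theta>)) (map (\<phi> (pt \<theta> s)) (F (fst i) (snd i)))"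
      if "i \<in> ?I" for i
      using that at_pt[OF \<theta>(1) _ s, of "fst i" _ "snd i"] by (simp add: G_def mem_Times_iff)
    have 0: "(\<Oplus>i\<in>?I. c i \<otimes> cf (lin_prod (map (R.at_dir r (w \<theta>))
        (map (\<phi> (pt \<theta> s)) (F (fst i) (snd i))))) k) = \<zero>"
    proof (rule coeff_combination_eq_0[OF _ c _ w[OF \<theta>(1)] _ k])
      show "set (map (\<phi> (pt \<theta> s)) (F (fst i) (snd i))) \<subseteq> R.affine_forms r" if "i \<in> ?I" for i
        using \<phi>[OF p, of "fst i" "snd i"] that by (simp add: mem_Times_iff)
      show "(\<Oplus>i\<in>?I. c i \<otimes> R.mcoeff r (map (\<phi> (pt \<theta> s)) (F (fst i) (snd i))) \<alpha>) = \<zero>"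
        if "\<alpha> \<in> {..<r} \<rightarrow>\<^sub>E {..<m}" for \<alpha>
        using bspec[OF c_ker, of "(pt \<theta> s, \<alpha>)"] p that by (simp add: T_def)
    qed (use fin in auto)
    have cl: "lin_prod (map (shift s) (G i)) \<in> carrier P" if "i \<in> ?I" for i
    proof (rule lin_prod_map_closed)
      fix x assume "x \<in> set (G i)"
      then have "x \<in> carrier R \<times> carrier R" using G[OF that] by blast
      then show "shift s x \<in> carrier R \<times> carrier R"
        using sR by (auto simp: shift_def)
    qed
    have "(\<Oplus>i\<in>?I. c i \<otimes> cf (lin_prod (map (shift s) (G i))) k) =
        (\<Oplus>i\<in>?I. c i \<otimes> cf (lin_prod (map (R.at_dir r (w \<theta>))
          (map (\<phi> (pt \<theta> s)) (F (fst i) (snd i))))) k)"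
    proof (intro R.finsum_cong' refl funcsetI)
      fix i assume i: "i \<in> ?I"
      show "c i \<otimes> cf (lin_prod (map (shift s) (G i))) k = c i \<otimes> cf (lin_prod (map (R.at_dir r (w \<theta>))
          (map (\<phi> (pt \<theta> s)) (F (fst i) (snd i))))) k"
        by (simp only: eq[OF i])
      show "c i \<otimes> cf (lin_prod (map (R.at_dir r (w \<theta>))
          (map (\<phi> (pt \<theta> s)) (F (fst i) (snd i))))) k \<in> carrier R"
        unfolding eq[OF i, symmetric] by (intro R.m_closed c i coeff_closed cl)
    qed
    then show "(\<Oplus>i\<in>?I. c i \<otimes> cf (lin_prod (map (shift s) (G i))) k) = \<zero>"
      unfolding 0 .
  qed (use fin c G S(1)[OF \<theta>(1)] finS in auto)
  let ?top = "foldr (\<lambda>f x. snd (g \<theta> f) \<otimes> x) (F \<theta> e) \<one>"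
  have top: "cf (lin_prod (G (\<theta>', e))) (d + e) = foldr (\<lambda>f x. snd (g \<theta> f) \<otimes> x) (F \<theta>' e) \<one>"
    if "\<theta>' \<in> \<Omega>" for \<theta>'
    using coeff_lin_prod_length[OF G, of "(\<theta>', e)"] lenG[of "(\<theta>', e)"] that e(1)
    by (simp add: G_def foldr_map comp_def)
  have top_closed: "?top \<in> carrier R"
    using top[OF \<theta>(1)] coeff_closed[OF lin_prod_closed[OF G]] \<theta>(1) e(1) by (metis SigmaI lessThan_iff)
  \<comment> \<open>In this degree the term \<open>(\<theta>, e)\<close> stands alone: larger
    \<open>e'\<close> have zero coefficients by maximality of \<open>e\<close>, smaller
    \<open>e'\<close> give too low a degree, and for \<open>e' = e\<close> the products of other
    directions vanish at \<theta>.\<close>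
  have "(\<Oplus>i\<in>?I. c i \<otimes> cf (lin_prod (G i)) (d + e)) = (\<Oplus>i\<in>?I. if (\<theta>, e) = i then c i \<otimes> ?top else \<zero>)"
  proof (intro R.finsum_cong' refl)
    fix i assume i: "i \<in> ?I"
    obtain \<theta>' e' where i': "i = (\<theta>', e')" "\<theta>' \<in> \<Omega>" "e' < N" using i by auto
    have cl: "c i \<in> carrier R" "cf (lin_prod (G i)) (d + e) \<in> carrier R"
      using c[OF i] coeff_closed[OF lin_prod_closed[OF G[OF i]]] by auto
    consider "e < e'" | "e' < e" | "e' = e" "\<theta>' \<noteq> \<theta>" | "e' = e" "\<theta>' = \<theta>" by fastforce
    then show "c i \<otimes> cf (lin_prod (G i)) (d + e) = (if (\<theta>, e) = i then c i \<otimes> ?top else \<zero>)"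
    proof cases
      case 1
      then show ?thesis using above[of \<theta>' e'] i' cl by auto
    next
      case 2
      then have "cf (lin_prod (G i)) (d + e) = \<zero>"
        using coeff_lin_prod_above[OF G[OF i]] lenG[OF i] i' by simp
      then show ?thesis using 2 i' cl by auto
    next
      case 3
      then have "cf (lin_prod (G i)) (d + e) = \<zero>"
        using top[OF i'(2)] vanish[OF \<theta>(1) i'(2)] i' by auto
      then show ?thesis using 3 i' cl by auto
    next
      case 4
      then show ?thesis using top[OF \<theta>(1)] i' by simp
    qed
  qed (use c top_closed in auto)
  also have "\<dots> = c (\<theta>, e) \<otimes> ?top"
    using \<theta>(1) e(1) fin(2) c top_closed by (intro R.finsum_singleton) auto
  finally have "c (\<theta>, e) \<otimes> ?top = \<zero>" using zero by simp
  then show False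
    using vanish[OF \<theta>(1) \<theta>(1)] e(2) c[of "(\<theta>, e)"] \<theta>(1) e(1) top_closed
    by (auto simp: R.integral_iff)
qed

section \<open>Horizontal lines\<close>

context field
begin

section \<open>Coordinates and horizontal derivatives\<close>

definition vcoord :: "nat \<Rightarrow> 'a vec2 \<Rightarrow> nat \<Rightarrow> 'a" where
  "vcoord n w i = (if i < n then fst w i else snd w (i - n))"

definition coord :: "nat \<Rightarrow> 'a vec2 \<times> 'a \<Rightarrow> nat \<Rightarrow> 'a" where
  "coord n u i = (if i < 2 * n then vcoord n (fst u) i else snd u)"

text \<open>
  \<open>grad n z i j\<close> is the derivative of the \<open>i\<close>-th coordinate of \<open>(z, t)\<close> along the \<open>j\<close>-th
  horizontal coordinate direction at \<open>(z, t)\<close>.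
\<close>

definition grad :: "nat \<Rightarrow> 'a vec2 \<Rightarrow> nat \<Rightarrow> nat \<Rightarrow> 'a" where
  "grad n z i j =
     (if i < 2 * n then (if i = j then \<one> else \<zero>)
      else if j < n then \<ominus> snd z j else fst z (j - n))"

lemma V_space_components:
  "z \<in> V_space R n \<Longrightarrow> fst z \<in> {..<n} \<rightarrow>\<^sub>E carrier R"
  "z \<in> V_space R n \<Longrightarrow> snd z \<in> {..<n} \<rightarrow>\<^sub>E carrier R"
  by (simp_all add: V_space_def mem_Times_iff)

lemma vcoord_closed: "w \<in> V_space R n \<Longrightarrow> i < 2 * n \<Longrightarrow> vcoord n w i \<in> carrier R"
  by (auto simp: vcoord_def V_coord)

lemma coord_closed: "fst u \<in> V_space R n \<Longrightarrow> snd u \<in> carrier R \<Longrightarrow> coord n u i \<in> carrier R"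
  by (auto simp: coord_def vcoord_closed)

lemma grad_closed: "z \<in> V_space R n \<Longrightarrow> j < 2 * n \<Longrightarrow> grad n z i j \<in> carrier R"
  by (auto simp: grad_def V_coord)

text \<open>A horizontal motion with spatial velocity \<open>w\<close> at a point over
  \<open>z\<close> has full velocity \<open>(w, sigma R n z w)\<close>, the vector that represents
  the refined direction.\<close>

lemma sum_grad:
  assumes z: "z \<in> V_space R n" and w: "w \<in> V_space R n"
  shows "(\<Oplus>j\<in>{..<2 * n}. grad n z i j \<otimes> vcoord n w j) = coord n (w, sigma R n z w) i"
proof (cases "i < 2 * n")
  case True
  have "(\<Oplus>j\<in>{..<2 * n}. grad n z i j \<otimes> vcoord n w j) = (\<Oplus>j\<in>{..<2 * n}. if i = j then vcoord n w j else \<zero>)"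
    using True w by (intro finsum_cong') (auto simp: grad_def vcoord_closed)
  also have "\<dots> = vcoord n w i"
    using True w by (intro finsum_singleton) (auto simp: vcoord_closed)
  finally show ?thesis using True by (simp add: coord_def)
next
  case False
  let ?f = "\<lambda>j. grad n z i j \<otimes> vcoord n w j"
  have f: "?f j \<in> carrier R" if "j < 2 * n" for j
    using that z w by (simp add: grad_closed vcoord_closed)
  have cl: "fst z j \<in> carrier R" "snd z j \<in> carrier R" "fst w j \<in> carrier R" "snd w j \<in> carrier R"
    if "j < n" for j using that z w by (simp_all add: V_coord)
  \<comment> \<open>Indices below \<open>n\<close> produce the negative term of
    \<open>sigma\<close>, and those from \<open>n\<close> on the positive one.\<close>
  have split: "{..<2 * n} = {..<n} \<union> (\<lambda>j. j + n) ` {..<n}"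
  proof (intro equalityI subsetI)
    fix j assume j: "j \<in> {..<2 * n}"
    show "j \<in> {..<n} \<union> (\<lambda>j. j + n) ` {..<n}"
    proof (cases "j < n")
      case False
      then have "j = (j - n) + n" "j - n \<in> {..<n}" using j by auto
      then show ?thesis by blast
    qed simp
  qed auto
  have "(\<Oplus>j\<in>{..<2 * n}. ?f j) = (\<Oplus>j\<in>{..<n}. ?f j) \<oplus> (\<Oplus>j\<in>(\<lambda>j. j + n) ` {..<n}. ?f j)"
    unfolding split using f by (intro finsum_Un_disjoint) auto
  also have "(\<Oplus>j\<in>(\<lambda>j. j + n) ` {..<n}. ?f j) = (\<Oplus>j\<in>{..<n}. ?f (j + n))"
    using f by (intro finsum_reindex) (auto simp: inj_on_def)
  also have "\<dots> = dot R n (fst z) (snd w)"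
    unfolding dot_def using False cl by (intro finsum_cong') (auto simp: grad_def vcoord_def)
  also have "(\<Oplus>j\<in>{..<n}. ?f j) = (\<Oplus>j\<in>{..<n}. \<ominus> (snd z j \<otimes> fst w j))"
    using False cl by (intro finsum_cong') (auto simp: grad_def vcoord_def l_minus)
  also have "\<dots> = \<ominus> dot R n (snd z) (fst w)"
  proof -
    have "(\<Oplus>j\<in>{..<n}. \<ominus> (snd z j \<otimes> fst w j)) = (\<Oplus>j\<in>{..<n}. (\<ominus> \<one>) \<otimes> (snd z j \<otimes> fst w j))"
      using cl by (intro finsum_cong') (auto simp: l_minus)
    also have "\<dots> = (\<ominus> \<one>) \<otimes> dot R n (snd z) (fst w)"
      unfolding dot_def using cl by (intro finsum_rdistr[symmetric]) auto
    also have "\<dots> = \<ominus> dot R n (snd z) (fst w)"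
      using cl by (simp add: l_minus dot_def finsum_closed)
    finally show ?thesis .
  qed
  finally have *: "(\<Oplus>j\<in>{..<2 * n}. ?f j) = \<ominus> dot R n (snd z) (fst w) \<oplus> dot R n (fst z) (snd w)" .
  have "dot R n (snd z) (fst w) \<in> carrier R" "dot R n (fst z) (snd w) \<in> carrier R"
    by (intro dot_closed V_space_components z w)+
  then have "(\<Oplus>j\<in>{..<2 * n}. ?f j) = sigma R n z w"
    unfolding * sigma_def by algebra
  then show ?thesis using False by (simp add: coord_def)
qed

text \<open>The nested restrictions are the form that \<open>V_add\<close> of a
  \<open>V_smult\<close> takes after unfolding.\<close>

lemma dot_add_smult:
  assumes "x \<in> {..<n} \<rightarrow>\<^sub>E carrier R" "u \<in> {..<n} \<rightarrow>\<^sub>E carrier R" "v \<in> {..<n} \<rightarrow>\<^sub>E carrier R"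
    and "s \<in> carrier R"
  shows "dot R n (\<lambda>i\<in>{..<n}. x i \<oplus> (\<lambda>i\<in>{..<n}. s \<otimes> u i) i) v = dot R n x v \<oplus> s \<otimes> dot R n u v"
proof -
  have cl: "x i \<in> carrier R" "u i \<in> carrier R" "v i \<in> carrier R" if "i < n" for i
    using that assms by auto
  have "dot R n (\<lambda>i\<in>{..<n}. x i \<oplus> (\<lambda>i\<in>{..<n}. s \<otimes> u i) i) v =
      (\<Oplus>i\<in>{..<n}. x i \<otimes> v i \<oplus> s \<otimes> (u i \<otimes> v i))"
    unfolding dot_def using cl assms(4) by (intro finsum_cong') (auto simp: l_distr m_assoc)
  also have "\<dots> = dot R n x v \<oplus> (\<Oplus>i\<in>{..<n}. s \<otimes> (u i \<otimes> v i))"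
    unfolding dot_def using cl assms(4) by (intro finsum_addf) auto
  also have "(\<Oplus>i\<in>{..<n}. s \<otimes> (u i \<otimes> v i)) = s \<otimes> dot R n u v"
    unfolding dot_def using cl assms(4) by (intro finsum_rdistr[symmetric]) auto
  finally show ?thesis .
qed

lemma dot_commute:
  assumes "x \<in> {..<n} \<rightarrow>\<^sub>E carrier R" "y \<in> {..<n} \<rightarrow>\<^sub>E carrier R"
  shows "dot R n x y = dot R n y x"
proof -
  have "x i \<in> carrier R" "y i \<in> carrier R" if "i < n" for i using that assms by auto
  then show ?thesis unfolding dot_def by (intro finsum_cong') (auto simp: m_comm)
qed

text \<open>Since \<open>sigma\<close> vanishes on the pair \<open>w\<close>, \<open>w\<close>,
  moving \<open>z\<close> along \<open>w\<close> does not change its pairing with \<open>w\<close>.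
  Hence all points of a horizontal line yield the same refined direction.\<close>

lemma sigma_translate:
  assumes z: "z \<in> V_space R n" and w: "w \<in> V_space R n" and s: "s \<in> carrier R"
  shows "sigma R n (V_add R n z (V_smult R n s w)) w = sigma R n z w"
proof -
  have m: "fst z \<in> {..<n} \<rightarrow>\<^sub>E carrier R" "snd z \<in> {..<n} \<rightarrow>\<^sub>E carrier R"
    "fst w \<in> {..<n} \<rightarrow>\<^sub>E carrier R" "snd w \<in> {..<n} \<rightarrow>\<^sub>E carrier R"
    by (intro V_space_components z w)+
  have cl: "dot R n (fst z) (snd w) \<in> carrier R" "dot R n (snd z) (fst w) \<in> carrier R"
    "dot R n (fst w) (snd w) \<in> carrier R"
    by (intro dot_closed m)+
  have 1: "dot R n (fst (V_add R n z (V_smult R n s w))) (snd w) =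
      dot R n (fst z) (snd w) \<oplus> s \<otimes> dot R n (fst w) (snd w)"
    unfolding V_add_def V_smult_def fst_conv using m s by (intro dot_add_smult)
  have 2: "dot R n (snd (V_add R n z (V_smult R n s w))) (fst w) =
      dot R n (snd z) (fst w) \<oplus> s \<otimes> dot R n (fst w) (snd w)"
    unfolding V_add_def V_smult_def snd_conv dot_commute[OF m(3,4)] using m s by (intro dot_add_smult)
  show ?thesis unfolding sigma_def 1 2 using cl s by algebra
qed

definition hpoint :: "nat \<Rightarrow> 'a vec2 \<times> 'a \<Rightarrow> 'a vec2 \<Rightarrow> 'a \<Rightarrow> 'a vec2 \<times> 'a" where
  "hpoint n p w s = (V_add R n (fst p) (V_smult R n s w), snd p \<oplus> s \<otimes> sigma R n (fst p) w)"

lemma coord_hpoint: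
  "coord n (hpoint n p w s) i = coord n p i \<oplus> s \<otimes> coord n (w, sigma R n (fst p) w) i"
  by (cases "i < n"; cases "i - n < n") (auto simp: coord_def hpoint_def vcoord_def V_add_def V_smult_def)

lemma proj_point_eqI:
  assumes w: "w \<in> V_space R n - {V_zero R n}" "c \<in> carrier R"
    and w': "w' \<in> V_space R n - {V_zero R n}" "c' \<in> carrier R"
    and s: "s \<in> carrier R" "\<And>i. i \<le> 2 * n \<Longrightarrow> coord n (w', c') i = s \<otimes> coord n (w, c) i"
  shows "proj_point R n w c = proj_point R n w' c'"
proof -
  have eq: "w' = V_smult R n s w"
  proof (rule V_eqI)
    fix i assume i: "i < n"
    show "fst w' i = fst (V_smult R n s w) i"
      using s(2)[of i] i by (simp add: coord_def vcoord_def V_smult_def)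
    show "snd w' i = snd (V_smult R n s w) i"
      using s(2)[of "n + i"] i by (simp add: coord_def vcoord_def V_smult_def)
  qed (use w w' s in \<open>auto simp: V_smult_closed\<close>)
  have "s \<noteq> \<zero>"
  proof
    assume "s = \<zero>"
    then have "w' = V_zero R n" using eq V_smult_zero[of w n] w(1) by simp
    then show False using w'(1) by simp
  qed
  moreover have "c' = s \<otimes> c" using s(2)[of "2 * n"] by (simp add: coord_def)
  ultimately have "((w, c), (w', c')) \<in> proj_rel R n"
    unfolding proj_rel_def using w w' s eq by auto
  then show ?thesis
    unfolding proj_point_def by (rule equiv_class_eq[OF equiv_proj_rel])
qed

lemma ex_vcoord_nonzero:
  assumes "w \<in> V_space R n - {V_zero R n}"
  shows "\<exists>k<2 * n. vcoord n w k \<noteq> \<zero>"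
proof (rule ccontr)
  assume "\<not> ?thesis"
  then have z: "vcoord n w k = \<zero>" if "k < 2 * n" for k using that by blast
  have "w = V_zero R n"
  proof (rule V_eqI)
    fix i assume "i < n"
    then show "fst w i = fst (V_zero R n) i" "snd w i = snd (V_zero R n) i"
      using z[of i] z[of "n + i"] by (simp_all add: vcoord_def V_zero_def)
  qed (use assms in \<open>auto simp: V_zero_closed\<close>)
  then show False using assms by simp
qed

text \<open>The triple \<open>(i, b, k)\<close> encodes the linear form \<open>x\<^sub>i - b x\<^sub>k\<close>.\<close>

definition form_val :: "nat \<Rightarrow> 'a vec2 \<times> 'a \<Rightarrow> nat \<times> 'a \<times> nat \<Rightarrow> 'a" where
  "form_val n u = (\<lambda>(i, b, k). coord n u i \<ominus> b \<otimes> coord n u k)"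

text \<open>The pullback of the linear form to the contact hyperplane at \<open>p = (z, t)\<close>,
  under \<open>w\<close> going to \<open>(z + w, t + sigma(z, w))\<close>. It is affine in
  \<open>w\<close> because \<open>sigma\<close> is linear in its second argument.\<close>

definition form_at :: "nat \<Rightarrow> 'a vec2 \<times> 'a \<Rightarrow> nat \<times> 'a \<times> nat \<Rightarrow> 'a \<times> (nat \<Rightarrow> 'a)" where
  "form_at n p f = (form_val n p f,
     case f of (i, b, k) \<Rightarrow> \<lambda>j. grad n (fst p) i j \<ominus> b \<otimes> grad n (fst p) k j)"

lemma form_val_closed:
  "fst u \<in> V_space R n \<Longrightarrow> snd u \<in> carrier R \<Longrightarrow> b \<in> carrier R \<Longrightarrow> form_val n u (i, b, k) \<in> carrier R"
  by (simp add: form_val_def coord_closed)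

text \<open>The slope follows from \<open>sum_grad\<close> by linearity. It is the value of the form
  at the refined direction, so leading coefficients on a line are values at its direction.\<close>

lemma at_dir_form_at:
  assumes p: "fst p \<in> V_space R n" and w: "w \<in> V_space R n" and b: "b \<in> carrier R"
  shows "at_dir (2 * n) (vcoord n w) (form_at n p (i, b, k)) =
    (form_val n p (i, b, k), form_val n (w, sigma R n (fst p) w) (i, b, k))"
proof -
  let ?g = "\<lambda>i j. grad n (fst p) i j \<otimes> vcoord n w j"
  have g: "grad n (fst p) i j \<in> carrier R" "vcoord n w j \<in> carrier R" if "j < 2 * n" for i j
    using that p w by (simp_all add: grad_closed vcoord_closed)
  have "(\<Oplus>j\<in>{..<2 * n}. (grad n (fst p) i j \<ominus> b \<otimes> grad n (fst p) k j) \<otimes> vcoord n w j) =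
      (\<Oplus>j\<in>{..<2 * n}. ?g i j \<oplus> (\<ominus> b) \<otimes> ?g k j)"
  proof (intro finsum_cong' refl)
    fix j assume "j \<in> {..<2 * n}"
    then have "grad n (fst p) i j \<in> carrier R" "grad n (fst p) k j \<in> carrier R" "vcoord n w j \<in> carrier R"
      using g by auto
    then show "(grad n (fst p) i j \<ominus> b \<otimes> grad n (fst p) k j) \<otimes> vcoord n w j = ?g i j \<oplus> (\<ominus> b) \<otimes> ?g k j"
      using b by algebra
  qed (use g b in auto)
  also have "\<dots> = (\<Oplus>j\<in>{..<2 * n}. ?g i j) \<oplus> (\<Oplus>j\<in>{..<2 * n}. (\<ominus> b) \<otimes> ?g k j)"
    using g b by (intro finsum_addf) auto
  also have "(\<Oplus>j\<in>{..<2 * n}. (\<ominus> b) \<otimes> ?g k j) = (\<ominus> b) \<otimes> (\<Oplus>j\<in>{..<2 * n}. ?g k j)"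
    using g b by (intro finsum_rdistr[symmetric]) auto
  finally have "(\<Oplus>j\<in>{..<2 * n}. (grad n (fst p) i j \<ominus> b \<otimes> grad n (fst p) k j) \<otimes> vcoord n w j) =
      coord n (w, sigma R n (fst p) w) i \<oplus> (\<ominus> b) \<otimes> coord n (w, sigma R n (fst p) w) k"
    unfolding sum_grad[OF p w] .
  moreover have "coord n (w, sigma R n (fst p) w) k \<in> carrier R"
    using p w by (intro coord_closed) (auto intro: sigma_closed)
  ultimately show ?thesis
    using b by (simp add: at_dir_def form_at_def form_val_def a_minus_def l_minus)
qed

text \<open>With \<open>at_dir_form_at\<close> and \<open>sigma_translate\<close>, this makes the
  expansion at the point of parameter \<open>s\<close> the \<open>shift s\<close> of the expansion
  at the base point.\<close>

lemma form_val_hpoint: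
  assumes p: "fst p \<in> V_space R n" "snd p \<in> carrier R" and w: "w \<in> V_space R n" and "s \<in> carrier R"
    and "b \<in> carrier R"
  shows "form_val n (hpoint n p w s) (i, b, k) =
    form_val n p (i, b, k) \<oplus> s \<otimes> form_val n (w, sigma R n (fst p) w) (i, b, k)"
proof -
  have "coord n p j \<in> carrier R" "coord n (w, sigma R n (fst p) w) j \<in> carrier R" for j
    using p w by (auto intro!: coord_closed sigma_closed)
  note cl = this[of i] this[of k]
  show ?thesis
    unfolding form_val_def prod.case coord_hpoint using cl assms(4,5) by algebra
qed

section \<open>Products of forms that separate directions\<close>

lemma foldr_mult_closed: "f ` set xs \<subseteq> carrier R \<Longrightarrow> foldr (\<lambda>x y. f x \<otimes> y) xs \<one> \<in> carrier R"
  by (induction xs) auto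

lemma foldr_mult_eq_0_iff:
  "f ` set xs \<subseteq> carrier R \<Longrightarrow> foldr (\<lambda>x y. f x \<otimes> y) xs \<one> = \<zero> \<longleftrightarrow> (\<exists>x\<in>set xs. f x = \<zero>)"
proof (induction xs)
  case (Cons x xs)
  then show ?case using integral_iff[of "f x" "foldr (\<lambda>x y. f x \<otimes> y) xs \<one>"] foldr_mult_closed[of f xs] by auto
qed simp

definition others :: "'a \<Rightarrow> 'a list" where
  "others a = (SOME xs. distinct xs \<and> set xs = carrier R - {a})"

lemma others:
  assumes "finite (carrier R)"
  shows "distinct (others a)" "set (others a) = carrier R - {a}"
proof -
  have "distinct (others a) \<and> set (others a) = carrier R - {a}"
    unfolding others_def
    by (rule someI_ex) (use finite_distinct_list[of "carrier R - {a}"] assms in blast)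
  then show "distinct (others a)" "set (others a) = carrier R - {a}" by simp_all
qed

lemma length_others:
  assumes "finite (carrier R)" "a \<in> carrier R"
  shows "length (others a) = card (carrier R) - 1"
  using distinct_card[OF others(1)[OF assms(1)], of a] assms by (simp add: others)

text \<open>
  At a direction not proportional to \<open>u\<close> one of these linear forms vanishes: either \<open>x\<^sub>k = 0\<close> there, or
  some ratio \<open>x\<^sub>i / x\<^sub>k\<close> differs from that of \<open>u\<close>. The last \<open>e\<close> factors \<open>x\<^sub>k\<close> only adjust the degree.
\<close>

definition sep_forms :: "nat \<Rightarrow> 'a vec2 \<times> 'a \<Rightarrow> nat \<Rightarrow> nat \<Rightarrow> (nat \<times> 'a \<times> nat) list" where
  "sep_forms n u k e =
     concat (map (\<lambda>i. map (\<lambda>b. (i, b, k)) (others (coord n u i \<otimes> inv (coord n u k)))) [0..<2 * n + 1]) @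
     replicate e (k, \<zero>, k)"

context
  fixes n u k
  assumes fin: "finite (carrier R)" and k: "k \<le> 2 * n" "coord n u k \<noteq> \<zero>"
    and u: "fst u \<in> V_space R n" "snd u \<in> carrier R"
begin

lemma ratio_closed: "coord n u i \<otimes> inv (coord n u k) \<in> carrier R"
proof -
  have "coord n u k \<in> Units R" using k u by (simp add: field_Units coord_closed)
  then show ?thesis using u by (simp add: coord_closed)
qed

lemma length_sep_forms: "length (sep_forms n u k e) = (2 * n + 1) * (card (carrier R) - 1) + e"
  by (simp add: sep_forms_def length_concat comp_def length_others[OF fin ratio_closed] sum_list_triv
      del: upt_Suc)

lemma set_sep_forms:
  "set (sep_forms n u k e) \<subseteq>
     {(i, b, k) | i b. i \<le> 2 * n \<and> b \<in> carrier R \<and> b \<noteq> coord n u i \<otimes> inv (coord n u k)} \<union> {(k, \<zero>, k)}"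
  "{(i, b, k) | i b. i \<le> 2 * n \<and> b \<in> carrier R \<and> b \<noteq> coord n u i \<otimes> inv (coord n u k)} \<subseteq>
     set (sep_forms n u k e)"
  by (auto simp: sep_forms_def others[OF fin] image_iff less_Suc_eq_le simp del: upt_Suc)

lemma sep_forms_nonzero:
  assumes "f \<in> set (sep_forms n u k e)"
  shows "form_val n u f \<noteq> \<zero>"
proof -
  have uk: "coord n u k \<in> Units R" "coord n u k \<in> carrier R"
    using k u by (simp_all add: field_Units coord_closed)
  consider i b where "f = (i, b, k)" "b \<in> carrier R" "b \<noteq> coord n u i \<otimes> inv (coord n u k)" |
    "f = (k, \<zero>, k)" using assms set_sep_forms(1)[of e] by blast
  then show ?thesis
  proof cases
    case 1
    have ui: "coord n u i \<in> carrier R" using u by (rule coord_closed)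
    show ?thesis
    proof
      assume "form_val n u f = \<zero>"
      then have "coord n u i = b \<otimes> coord n u k" using 1 ui uk by (simp add: form_val_def)
      then have "coord n u i \<otimes> inv (coord n u k) = b" using 1 uk by (simp add: m_assoc)
      then show False using 1 by simp
    qed
  next
    case 2
    then show ?thesis using k uk by (simp add: form_val_def a_minus_def)
  qed
qed

text \<open>The scalars \<open>b\<close> run through all ratios except that of \<open>u\<close>. If
  no form vanishes at \<open>v\<close>, each ratio of coordinate \<open>i\<close> to coordinate
  \<open>k\<close> must agree with that of \<open>u\<close>.\<close>

lemma sep_forms_all_nonzero_imp_proportional:
  assumes v: "fst v \<in> V_space R n" "snd v \<in> carrier R"
    and nz: "\<And>f. f \<in> set (sep_forms n u k e) \<Longrightarrow> form_val n v f \<noteq> \<zero>"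
  shows "\<exists>s\<in>carrier R. \<forall>i\<le>2 * n. coord n v i = s \<otimes> coord n u i"
proof -
  have uk: "coord n u k \<in> Units R" "coord n u k \<in> carrier R"
    using k u by (simp_all add: field_Units coord_closed)
  have cv: "coord n v i \<in> carrier R" and cu: "coord n u i \<in> carrier R" for i
    using u v by (simp_all add: coord_closed)
  have nz': "coord n v i \<noteq> b \<otimes> coord n v k"
    if "i \<le> 2 * n" "b \<in> carrier R" "b \<noteq> coord n u i \<otimes> inv (coord n u k)" for i b
    using nz[of "(i, b, k)"] set_sep_forms(2)[of e] that cv by (auto simp: form_val_def)
  \<comment> \<open>For \<open>i = k\<close> the excluded ratio is 1, so \<open>b\<close> = 0 is
    allowed and the coordinate \<open>k\<close> itself is among the forms.\<close>
  have vk: "coord n v k \<noteq> \<zero>"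
    using nz'[of k \<zero>] k uk cv by auto
  then have vk: "coord n v k \<in> Units R" "coord n v k \<in> carrier R"
    using cv by (simp_all add: field_Units)
  define s where "s = coord n v k \<otimes> inv (coord n u k)"
  have s: "s \<in> carrier R" using uk vk by (simp add: s_def)
  have "coord n v i = s \<otimes> coord n u i" if i: "i \<le> 2 * n" for i
  proof -
    have "coord n v i = coord n v i \<otimes> inv (coord n v k) \<otimes> coord n v k"
      using vk cv by (simp add: m_assoc)
    then have "coord n v i \<otimes> inv (coord n v k) = coord n u i \<otimes> inv (coord n u k)"
      using nz'[OF i, of "coord n v i \<otimes> inv (coord n v k)"] vk cv by auto
    then have "coord n v i = coord n u i \<otimes> inv (coord n u k) \<otimes> coord n v k"
      using vk cv by (metis Units_inv_closed Units_l_inv m_assoc r_one)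
    then show ?thesis using uk cu vk by (simp add: s_def m_ac)
  qed
  then show ?thesis using s by blast
qed

end

end

lemma (in field) mem_sep_forms:
  assumes "finite (carrier R)" "k \<le> 2 * n" "coord n u k \<noteq> \<zero>" "fst u \<in> V_space R n" "snd u \<in> carrier R"
    and "f \<in> set (sep_forms n u k e)"
  obtains i b where "f = (i, b, k)" "b \<in> carrier R"
  using subsetD[OF set_sep_forms(1)[OF assms(1-5)] assms(6)] by auto

section \<open>The estimate for lines with distinct refined directions\<close>

lemma (in field) finite_heisenberg:
  "finite (carrier R) \<Longrightarrow> finite (carrier (heisenberg R n))"
  by (simp add: heisenberg_def V_space_def finite_PiE)

text \<open>This is \<open>multiplicity_bound\<close> with \<open>N\<close> equal to the field size
  q and \<open>d = (2n + 1)(q - 1)\<close>. Then \<open>d + N\<close> is at most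
  \<open>(2n + 2) q\<close>, which explains the hypothesis on \<open>l * m\<close>.\<close>

lemma (in field) hline_bound:
  fixes n l m :: nat and p :: "'i \<Rightarrow> 'a vec2 \<times> 'a" and w :: "'i \<Rightarrow> 'a vec2"
  assumes fin: "finite (carrier R)" "finite \<Omega>" and E: "E \<subseteq> carrier (heisenberg R n)"
    and p: "\<And>\<theta>. \<theta> \<in> \<Omega> \<Longrightarrow> p \<theta> \<in> carrier (heisenberg R n)"
    and w: "\<And>\<theta>. \<theta> \<in> \<Omega> \<Longrightarrow> w \<theta> \<in> V_space R n - {V_zero R n}"
    and inj: "inj_on (\<lambda>\<theta>. proj_point R n (w \<theta>) (sigma R n (fst (p \<theta>)) (w \<theta>))) \<Omega>"
    and l: "\<And>\<theta>. \<theta> \<in> \<Omega> \<Longrightarrow> l \<le> card (E \<inter> hline R n (p \<theta>) (w \<theta>))"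
    and m: "(2 * n + 2) * card (carrier R) \<le> l * m"
  shows "card (carrier R) * card \<Omega> \<le> card E * m ^ (2 * n)"
proof -
  interpret U: UP_domain R "UP R"
    by (rule UP_domain.intro) (rule domain_axioms)
  have pV: "fst (p \<theta>) \<in> V_space R n" "snd (p \<theta>) \<in> carrier R" if "\<theta> \<in> \<Omega>" for \<theta>
    using p[OF that] by (auto simp: heisenberg_def)
  have wV: "w \<theta> \<in> V_space R n" if "\<theta> \<in> \<Omega>" for \<theta> using w[OF that] by simp
  define u where "u = (\<lambda>\<theta>. (w \<theta>, sigma R n (fst (p \<theta>)) (w \<theta>)))"
  have u: "fst (u \<theta>) \<in> V_space R n" "snd (u \<theta>) \<in> carrier R" if "\<theta> \<in> \<Omega>" for \<theta>
    using pV(1)[OF that] wV[OF that] by (simp_all add: u_def sigma_closed)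
  \<comment> \<open>The pivot is taken among the spatial coordinates, where a nonzero entry exists
    because \<open>w \<theta>\<close> is nonzero.\<close>
  define k where "k = (\<lambda>\<theta>. SOME k. k < 2 * n \<and> vcoord n (w \<theta>) k \<noteq> \<zero>)"
  have k: "k \<theta> \<le> 2 * n" "coord n (u \<theta>) (k \<theta>) \<noteq> \<zero>" if "\<theta> \<in> \<Omega>" for \<theta>
  proof -
    have "k \<theta> < 2 * n \<and> vcoord n (w \<theta>) (k \<theta>) \<noteq> \<zero>"
      unfolding k_def by (rule someI_ex) (use ex_vcoord_nonzero[OF w[OF that]] in blast)
    then show "k \<theta> \<le> 2 * n" "coord n (u \<theta>) (k \<theta>) \<noteq> \<zero>" by (simp_all add: coord_def u_def)
  qed
  define F where "F = (\<lambda>\<theta>. sep_forms n (u \<theta>) (k \<theta>))"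
  have F: "\<exists>i b. f = (i, b, k \<theta>) \<and> b \<in> carrier R" if "\<theta> \<in> \<Omega>" "f \<in> set (F \<theta> e)" for f \<theta> e
    using mem_sep_forms[OF fin(1) k[OF that(1)] u[OF that(1)]] that(2) unfolding F_def by metis
  define S where "S = (\<lambda>\<theta>. {s \<in> carrier R. hpoint n (p \<theta>) (w \<theta>) s \<in> E})"
  show ?thesis
  proof (rule U.multiplicity_bound[where \<phi> = "form_at n" and F = F and w = "\<lambda>\<theta>. vcoord n (w \<theta>)"
        and S = S and pt = "\<lambda>\<theta>. hpoint n (p \<theta>) (w \<theta>)" and l = l and d = "(2 * n + 1) * (card (carrier R) - 1)"
        and g = "\<lambda>\<theta> f. (form_val n (p \<theta>) f, form_val n (u \<theta>) f)"])
    show "field R" by (rule field_axioms)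
    show "finite (carrier R)" "finite \<Omega>" by (fact fin)+
    show "finite E" using E finite_heisenberg[OF fin(1)] by (rule finite_subset)
    show "form_at n x ` set (F \<theta> e) \<subseteq> affine_forms (2 * n)" if t: "x \<in> E" "\<theta> \<in> \<Omega>" for x \<theta> e
    proof (rule image_subsetI)
      fix f assume "f \<in> set (F \<theta> e)"
      then obtain i b where f: "f = (i, b, k \<theta>)" "b \<in> carrier R" using F[OF t(2)] by blast
      have x: "fst x \<in> V_space R n" "snd x \<in> carrier R"
        using t(1) E by (auto simp: heisenberg_def)
      show "form_at n x f \<in> affine_forms (2 * n)"
        unfolding form_at_def f(1) using form_val_closed[OF x f(2)] f(2) grad_closed[OF x(1)] by simp
    qed
    show "(\<lambda>f. (form_val n (p \<theta>) f, form_val n (u \<theta>) f)) ` set (F \<theta>' e) \<subseteq> carrier R \<times> carrier R"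
      if t: "\<theta> \<in> \<Omega>" "\<theta>' \<in> \<Omega>" for \<theta> \<theta>' e
    proof (rule image_subsetI)
      fix f assume "f \<in> set (F \<theta>' e)"
      then obtain i b where f: "f = (i, b, k \<theta>')" "b \<in> carrier R" using F[OF t(2)] by blast
      show "(form_val n (p \<theta>) f, form_val n (u \<theta>) f) \<in> carrier R \<times> carrier R"
        unfolding f(1) using form_val_closed[OF pV[OF t(1)] f(2)] form_val_closed[OF u[OF t(1)] f(2)] by simp
    qed
    show "vcoord n (w \<theta>) \<in> {..<2 * n} \<rightarrow> carrier R" if "\<theta> \<in> \<Omega>" for \<theta>
      using vcoord_closed[OF wV[OF that]] by simp
    show "S \<theta> \<subseteq> carrier R" for \<theta> by (auto simp: S_def)
    show "l \<le> card (S \<theta>)" if "\<theta> \<in> \<Omega>" for \<theta>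
    proof -
      have "E \<inter> hline R n (p \<theta>) (w \<theta>) \<subseteq> hpoint n (p \<theta>) (w \<theta>) ` S \<theta>"
        by (auto simp: hline_def S_def hpoint_def)
      moreover have fS: "finite (S \<theta>)" using fin by (simp add: S_def)
      ultimately have "card (E \<inter> hline R n (p \<theta>) (w \<theta>)) \<le> card (S \<theta>)"
        by (meson card_image_le card_mono finite_imageI le_trans)
      then show ?thesis using l[OF that] by simp
    qed
    show "hpoint n (p \<theta>) (w \<theta>) s \<in> E" if "s \<in> S \<theta>" for \<theta> s
      using that by (simp add: S_def)
    show "at_dir (2 * n) (vcoord n (w \<theta>)) (form_at n (hpoint n (p \<theta>) (w \<theta>) s) f) =
        U.shift s (form_val n (p \<theta>) f, form_val n (u \<theta>) f)"
      if t: "\<theta> \<in> \<Omega>" "\<theta>' \<in> \<Omega>" "s \<in> S \<theta>" "f \<in> set (F \<theta>' e)" for \<theta> \<theta>' s e f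
    proof -
      obtain i b where f: "f = (i, b, k \<theta>')" "b \<in> carrier R" using F[OF t(2,4)] by blast
      have s: "s \<in> carrier R" using t(3) by (simp add: S_def)
      note pw = pV[OF t(1)] wV[OF t(1)]
      have "fst (hpoint n (p \<theta>) (w \<theta>) s) \<in> V_space R n"
        using pw s by (simp add: hpoint_def V_add_closed V_smult_closed)
      \<comment> \<open>The contact hyperplane at each point of the line contains the same direction
        vector, so the slope stays fixed and only the constant term is shifted.\<close>
      moreover have "sigma R n (fst (hpoint n (p \<theta>) (w \<theta>) s)) (w \<theta>) = sigma R n (fst (p \<theta>)) (w \<theta>)"
        unfolding hpoint_def fst_conv by (rule sigma_translate[OF pw(1,3) s])
      ultimately show ?thesis
        unfolding f(1) by (simp add: at_dir_form_at pw f(2) form_val_hpoint[OF pw s f(2)] U.shift_def u_def)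
    qed
    show "length (F \<theta> e) = (2 * n + 1) * (card (carrier R) - 1) + e" if "\<theta> \<in> \<Omega>" for \<theta> e
      unfolding F_def by (rule length_sep_forms[OF fin(1) k[OF that] u[OF that]])
    have "(2 * n + 1) * (card (carrier R) - 1) \<le> (2 * n + 1) * card (carrier R)"
      by (rule mult_le_mono2) simp
    then show "(2 * n + 1) * (card (carrier R) - 1) + card (carrier R) \<le> l * m"
      using m by (simp add: algebra_simps)
    show "foldr (\<lambda>f x. snd (form_val n (p \<theta>) f, form_val n (u \<theta>) f) \<otimes> x) (F \<theta>' e) \<one> = \<zero> \<longleftrightarrow> \<theta> \<noteq> \<theta>'"
      if t: "\<theta> \<in> \<Omega>" "\<theta>' \<in> \<Omega>" for \<theta> \<theta>' e
    proof -
      note sep = fin(1) k[OF t(2)] u[OF t(2)]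
      have "form_val n (u \<theta>) ` set (F \<theta>' e) \<subseteq> carrier R"
      proof (rule image_subsetI)
        fix f assume "f \<in> set (F \<theta>' e)"
        then obtain i b where f: "f = (i, b, k \<theta>')" "b \<in> carrier R" using F[OF t(2)] by blast
        then show "form_val n (u \<theta>) f \<in> carrier R" using form_val_closed[OF u[OF t(1)]] by simp
      qed
      note iff = foldr_mult_eq_0_iff[OF this]
      \<comment> \<open>If no separating form of \<theta>' vanishes at \<theta>, the two direction
        vectors are proportional, and injectivity identifies the indices.\<close>
      have "\<theta> = \<theta>'" if nz: "\<And>f. f \<in> set (F \<theta>' e) \<Longrightarrow> form_val n (u \<theta>) f \<noteq> \<zero>"
      proof -
        obtain s where s: "s \<in> carrier R" "\<forall>i\<le>2 * n. coord n (u \<theta>) i = s \<otimes> coord n (u \<theta>') i"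
          using sep_forms_all_nonzero_imp_proportional[OF sep u[OF \<open>\<theta> \<in> \<Omega>\<close>], of e] nz
          unfolding F_def by blast
        have "proj_point R n (w \<theta>') (snd (u \<theta>')) = proj_point R n (w \<theta>) (snd (u \<theta>))"
          using s u[OF \<open>\<theta> \<in> \<Omega>\<close>] u[OF \<open>\<theta>' \<in> \<Omega>\<close>] w \<open>\<theta> \<in> \<Omega>\<close> \<open>\<theta>' \<in> \<Omega>\<close>
          by (intro proj_point_eqI[where s = s]) (auto simp: u_def)
        then show ?thesis
          using inj_onD[OF inj, of \<theta> \<theta>'] \<open>\<theta> \<in> \<Omega>\<close> \<open>\<theta>' \<in> \<Omega>\<close> by (simp add: u_def)
      qed
      moreover have "form_val n (u \<theta>') f \<noteq> \<zero>" if "f \<in> set (F \<theta>' e)" for f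
        using sep_forms_nonzero[OF sep] that unfolding F_def by blast
      ultimately show ?thesis unfolding snd_conv iff by blast
    qed
  qed
qed

section \<open>Choice of the multiplicity and of the constant\<close>

theorem theorem1p3:
  fixes n :: nat
  assumes "n \<ge> 2"
  shows "\<exists>c>0::real. \<forall>(R :: 'a ring) (q :: nat) \<Omega> E (l :: nat).
           field R \<and> finite (carrier R) \<and> card (carrier R) = q \<and> odd q \<and>
           \<Omega> \<noteq> {} \<and> \<Omega> \<subseteq> refined_directions R n \<and>
           E \<subseteq> carrier (heisenberg R n) \<and>
           1 \<le> l \<and> l \<le> q \<and>
           (\<forall>\<theta>\<in>\<Omega>. \<exists>L\<in>horizontal_lines R n. Dir R n L = \<theta> \<and> card (E \<inter> L) \<ge> l)
           \<longrightarrow> real (card E) \<ge> c * real l ^ (2 * n) * real (card \<Omega>) / real q ^ (2 * n - 1)"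
proof (intro exI[of _ "1 / real (2 * n + 3) ^ (2 * n)"] conjI allI impI; (elim conjE)?)
  \<comment> \<open>The base \<open>2 * n + 3\<close> comes from the upper bound
    \<open>(2 * n + 3) * q\<close> for \<open>l * m\<close> below, raised to the dimension
    \<open>2 * n\<close> of the contact hyperplane.\<close>
  show "0 < 1 / real (2 * n + 3) ^ (2 * n)" by simp
  fix R :: "'a ring" and q l :: nat and \<Omega> :: "('a vec2 \<times> 'a) set set" and E
  assume R: "field R" and fin: "finite (carrier R)" and q: "card (carrier R) = q"
    and \<Omega>: "\<Omega> \<subseteq> refined_directions R n" and E: "E \<subseteq> carrier (heisenberg R n)"
    and l: "1 \<le> l" "l \<le> q"
    and lines: "\<forall>\<theta>\<in>\<Omega>. \<exists>L\<in>horizontal_lines R n. Dir R n L = \<theta> \<and> l \<le> card (E \<inter> L)"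
  interpret field R by (rule R)
  have "\<forall>\<theta>\<in>\<Omega>. \<exists>p w. p \<in> carrier (heisenberg R n) \<and> w \<in> V_space R n - {V_zero R n} \<and>
      proj_point R n w (sigma R n (fst p) w) = \<theta> \<and> l \<le> card (E \<inter> hline R n p w)"
  proof
    fix \<theta> assume "\<theta> \<in> \<Omega>"
    then obtain L where L: "L \<in> horizontal_lines R n" "Dir R n L = \<theta>" "l \<le> card (E \<inter> L)"
      using lines by blast
    from L(1) obtain p w where pw: "p \<in> carrier (heisenberg R n)" "w \<in> V_space R n - {V_zero R n}"
      "L = hline R n p w" unfolding horizontal_lines_def by blast
    then show "\<exists>p w. p \<in> carrier (heisenberg R n) \<and> w \<in> V_space R n - {V_zero R n} \<and>
        proj_point R n w (sigma R n (fst p) w) = \<theta> \<and> l \<le> card (E \<inter> hline R n p w)"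
      using L(2,3) Dir_hline[OF pw(1,2)] by blast
  qed
  then obtain p w where pw: "\<And>\<theta>. \<theta> \<in> \<Omega> \<Longrightarrow> p \<theta> \<in> carrier (heisenberg R n)"
      "\<And>\<theta>. \<theta> \<in> \<Omega> \<Longrightarrow> w \<theta> \<in> V_space R n - {V_zero R n}"
      "\<And>\<theta>. \<theta> \<in> \<Omega> \<Longrightarrow> proj_point R n (w \<theta>) (sigma R n (fst (p \<theta>)) (w \<theta>)) = \<theta>"
      "\<And>\<theta>. \<theta> \<in> \<Omega> \<Longrightarrow> l \<le> card (E \<inter> hline R n (p \<theta>) (w \<theta>))"
    by metis
  have "refined_directions R n \<subseteq> (\<lambda>(w, c). proj_point R n w c) ` carrier (heisenberg R n)"
    by (auto simp: refined_directions_def heisenberg_def)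
  then have fin\<Omega>: "finite \<Omega>"
    using \<Omega> finite_heisenberg[OF fin, of n] by (meson finite_imageI finite_subset)
  \<comment> \<open>Adding 1 to the integer quotient ensures that \<open>l * m\<close> reaches
    \<open>(2 * n + 2) * q\<close>. The excess is at most \<open>l\<close>, hence at most
    \<open>q\<close>.\<close>
  define m where "m = (2 * n + 2) * q div l + 1"
  have m: "(2 * n + 2) * q \<le> l * m" "l * m \<le> (2 * n + 3) * q"
  proof -
    have "(2 * n + 2) * q = l * ((2 * n + 2) * q div l) + (2 * n + 2) * q mod l" by simp
    moreover have "(2 * n + 2) * q mod l < l" using l by simp
    moreover have "l * m = l * ((2 * n + 2) * q div l) + l" by (simp add: m_def)
    moreover have "(2 * n + 3) * q = (2 * n + 2) * q + q" by (simp add: algebra_simps)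
    ultimately show "(2 * n + 2) * q \<le> l * m" "l * m \<le> (2 * n + 3) * q"
      using l by linarith+
  qed
  have "inj_on (\<lambda>\<theta>. proj_point R n (w \<theta>) (sigma R n (fst (p \<theta>)) (w \<theta>))) \<Omega>"
    using pw(3) by (auto intro!: inj_onI)
  then have "q * card \<Omega> \<le> card E * m ^ (2 * n)"
    using hline_bound[OF fin fin\<Omega> E pw(1,2) _ pw(4)] m(1) q by simp
  \<comment> \<open>Multiplying by \<open>l ^ (2 * n)\<close> produces the power of
    \<open>l * m\<close>, which is bounded by a multiple of \<open>q\<close>.\<close>
  then have "l ^ (2 * n) * (q * card \<Omega>) \<le> l ^ (2 * n) * (card E * m ^ (2 * n))" by (rule mult_le_mono2)
  also have "\<dots> = card E * (l * m) ^ (2 * n)" by (simp add: power_mult_distrib)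
  also have "\<dots> \<le> card E * ((2 * n + 3) * q) ^ (2 * n)"
    using m(2) by (intro mult_le_mono2 power_mono) auto
  \<comment> \<open>One factor \<open>q\<close> is split off to cancel the \<open>q\<close> on the
    left, which leaves the exponent \<open>2 * n - 1\<close>.\<close>
  also have "\<dots> = card E * (2 * n + 3) ^ (2 * n) * q ^ (2 * n - 1) * q"
    using assms by (simp add: power_mult_distrib mult.assoc power_Suc2[symmetric] del: power_Suc)
  finally have "l ^ (2 * n) * card \<Omega> * q \<le> card E * (2 * n + 3) ^ (2 * n) * q ^ (2 * n - 1) * q"
    by (simp add: mult_ac)
  then have "l ^ (2 * n) * card \<Omega> \<le> card E * (2 * n + 3) ^ (2 * n) * q ^ (2 * n - 1)"
    using l by simp
  then have "real (l ^ (2 * n) * card \<Omega>) \<le> real (card E * (2 * n + 3) ^ (2 * n) * q ^ (2 * n - 1))"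
    by (rule of_nat_mono)
  then have *: "real l ^ (2 * n) * real (card \<Omega>) \<le> real (card E) * real (2 * n + 3) ^ (2 * n) * real q ^ (2 * n - 1)"
    by (simp only: of_nat_mult of_nat_power)
  have "0 < real (2 * n + 3) ^ (2 * n) * real q ^ (2 * n - 1)" using l by simp
  then have "real l ^ (2 * n) * real (card \<Omega>) / (real (2 * n + 3) ^ (2 * n) * real q ^ (2 * n - 1)) \<le> real (card E)"
    using * by (simp only: pos_divide_le_eq mult.assoc)
  then show "1 / real (2 * n + 3) ^ (2 * n) * real l ^ (2 * n) * real (card \<Omega>) / real q ^ (2 * n - 1) \<le> real (card E)"
    by (simp add: mult_ac)
qed

end
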